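(* Let $0<c<1$. For a sequence $(t_n)_{n\geq1}$ of positive reals define $F_n(z,w)=\big(z^2+c^{t_n^n}w,\ c^{t_n^n}z\big)$ and let $\Omega=\{(z,w)\in\mathbb{C}^2: F_n\circ\cdots\circ F_1(z,w)\to0\}$ be the non-autonomous basin of attraction at the origin. Then: (A) there exists a sequence $t_n\to2$ for which $\Omega$ is a Short $\mathbb{C}^2$; (B) there exists a sequence $t_n\to2$ for which $\Omega$ is a Fatou–Bieberbach domain.
   Context: A Fatou–Bieberbach domain is a proper subdomain of $\mathbb{C}^k$ that is biholomorphic to $\mathbb{C}^k$. Definition (Short $\mathbb{C}^k$): for $k\geq 2$, a domain $\Omega\subseteq\mathbb{C}^k$ is a Short $\mathbb{C}^k$ if it is the union of an increasing sequence of domains each biholomorphic to the unit ball of $\mathbb{C}^k$, its Kobayashi–Royden infinitesimal pseudometric vanishes identically, and it carries a non-constant plurisubharmonic function bounded above. *)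

theory Defs
  imports "HOL-Analysis.Analysis" "HOL-Complex_Analysis.Complex_Analysis"
begin

text \<open>We model C^2 as the product type complex \<times> complex (its norm is the Euclidean one).\<close>

type_synonym c2 = "complex \<times> complex"

definition cscale2 :: "complex \<Rightarrow> c2 \<Rightarrow> c2" where
  "cscale2 a v = (a * fst v, a * snd v)"

definition clinear2 :: "(c2 \<Rightarrow> c2) \<Rightarrow> bool" where
  "clinear2 L \<longleftrightarrow> linear L \<and> (\<forall>a v. L (cscale2 a v) = cscale2 a (L v))"

definition holo2_on :: "(c2 \<Rightarrow> c2) \<Rightarrow> c2 set \<Rightarrow> bool" where
  "holo2_on f U \<longleftrightarrow> (\<forall>x\<in>U. \<exists>L. clinear2 L \<and> (f has_derivative L) (at x))"

definition domain2 :: "c2 set \<Rightarrow> bool" where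
  "domain2 U \<longleftrightarrow> open U \<and> connected U \<and> U \<noteq> {}"

definition biholomorphic2 :: "c2 set \<Rightarrow> c2 set \<Rightarrow> bool" where
  "biholomorphic2 U V \<longleftrightarrow> open U \<and> open V \<and>
     (\<exists>f g. holo2_on f U \<and> holo2_on g V \<and> f ` U = V \<and> g ` V = U \<and>
        (\<forall>x\<in>U. g (f x) = x) \<and> (\<forall>y\<in>V. f (g y) = y))"

definition fatou_bieberbach :: "c2 set \<Rightarrow> bool" where
  "fatou_bieberbach \<Omega> \<longleftrightarrow> domain2 \<Omega> \<and> \<Omega> \<noteq> UNIV \<and> biholomorphic2 \<Omega> UNIV"

definition holo_disc :: "(complex \<Rightarrow> c2) \<Rightarrow> bool" where
  "holo_disc \<phi> \<longleftrightarrow> (fst \<circ> \<phi>) holomorphic_on ball 0 1 \<and> (snd \<circ> \<phi>) holomorphic_on ball 0 1"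

definition kobayashi_royden :: "c2 set \<Rightarrow> c2 \<Rightarrow> c2 \<Rightarrow> real" where
  "kobayashi_royden \<Omega> p v = Inf {1 / r | r. r > 0 \<and>
      (\<exists>\<phi>. holo_disc \<phi> \<and> \<phi> ` ball 0 1 \<subseteq> \<Omega> \<and> \<phi> 0 = p \<and>
            (deriv (fst \<circ> \<phi>) 0, deriv (snd \<circ> \<phi>) 0) = cscale2 (complex_of_real r) v)}"

definition usc_on :: "c2 set \<Rightarrow> (c2 \<Rightarrow> ereal) \<Rightarrow> bool" where
  "usc_on U u \<longleftrightarrow> (\<forall>x\<in>U. \<forall>s. u x < s \<longrightarrow> (\<forall>\<^sub>F y in at x within U. u y < s))"

text \<open>Mean of u over the circle a + e^{i theta} b, theta in [0, 2 pi], as an extended real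
  (positive part minus negative part; the positive part is finite for usc u).\<close>
definition circle_mean :: "(c2 \<Rightarrow> ereal) \<Rightarrow> c2 \<Rightarrow> c2 \<Rightarrow> ereal" where
  "circle_mean u a b =
     (let g = (\<lambda>\<theta>::real. u (a + cscale2 (cis \<theta>) b)) in
      (enn2ereal (\<integral>\<^sup>+ \<theta>. e2ennreal (max (g \<theta>) 0) * indicator {0..2*pi} \<theta> \<partial>lborel)
       - enn2ereal (\<integral>\<^sup>+ \<theta>. e2ennreal (max (- g \<theta>) 0) * indicator {0..2*pi} \<theta> \<partial>lborel))
      / ereal (2 * pi))"

definition psh_on :: "c2 set \<Rightarrow> (c2 \<Rightarrow> ereal) \<Rightarrow> bool" where
  "psh_on U u \<longleftrightarrow> (\<forall>x\<in>U. u x \<noteq> \<infinity>) \<and> usc_on U u \<and>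
     (\<forall>a b. (\<forall>z. cmod z \<le> 1 \<longrightarrow> a + cscale2 z b \<in> U) \<longrightarrow> u a \<le> circle_mean u a b)"

definition short_C2 :: "c2 set \<Rightarrow> bool" where
  "short_C2 \<Omega> \<longleftrightarrow> domain2 \<Omega> \<and>
     (\<exists>B :: nat \<Rightarrow> c2 set. (\<forall>j. domain2 (B j) \<and> biholomorphic2 (B j) (ball 0 1) \<and> B j \<subseteq> B (Suc j))
        \<and> (\<Union>j. B j) = \<Omega>) \<and>
     (\<forall>p\<in>\<Omega>. \<forall>v. kobayashi_royden \<Omega> p v = 0) \<and>
     (\<exists>u. psh_on \<Omega> u \<and> (\<exists>M::real. \<forall>x\<in>\<Omega>. u x \<le> M) \<and> (\<exists>x\<in>\<Omega>. \<exists>y\<in>\<Omega>. u x \<noteq> u y))"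

text \<open>The maps F_n (n \<ge> 1), their compositions and the basin. The sequence t is indexed
  from 1; t 0 is irrelevant.\<close>
definition Fmap :: "real \<Rightarrow> (nat \<Rightarrow> real) \<Rightarrow> nat \<Rightarrow> c2 \<Rightarrow> c2" where
  "Fmap c t n p = (let a = complex_of_real (c powr (t n ^ n)) in
      ((fst p)\<^sup>2 + a * snd p, a * fst p))"

fun Fcomp :: "real \<Rightarrow> (nat \<Rightarrow> real) \<Rightarrow> nat \<Rightarrow> c2 \<Rightarrow> c2" where
  "Fcomp c t 0 p = p"
| "Fcomp c t (Suc n) p = Fmap c t (Suc n) (Fcomp c t n p)"

definition basin :: "real \<Rightarrow> (nat \<Rightarrow> real) \<Rightarrow> c2 set" where
  "basin c t = {p. (\<lambda>n. Fcomp c t n p) \<longlonglongrightarrow> 0}"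

end

theory Submission
  imports Defs "HOL-Real_Asymp.Real_Asymp"
begin

text \<open>
  Write \<open>a\<^sub>n = exp (- s\<^sub>n)\<close> for the coefficient of the \<open>n\<close>-th map. Every positive sequence with
  \<open>s\<^sub>n powr (1/n) \<longlonglongrightarrow> 2\<close> arises from some \<open>t\<^sub>n \<longlonglongrightarrow> 2\<close>, which leaves room on both sides of the
  critical growth \<open>2^n\<close>.

  (A) If \<open>s\<^sub>n\<close> is a multiple of \<open>2^n\<close>, then with \<open>m\<^sub>n = max (max |z\<^sub>n| |w\<^sub>n|) a\<^sub>n\<^sub>+\<^sub>1\<close> the functions
  \<open>2^-n ln (2 m\<^sub>n)\<close> decrease to a bounded, non-constant plurisubharmonic function. The basin is the
  increasing union of the preimages of a small ball, and discs in that ball pull back to arbitrarily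
  large discs because the derivatives of the iterates tend to zero along orbits.

  (B) If \<open>s\<^sub>n = o(2^n)\<close> grows regularly, every orbit in the basin eventually drops below \<open>a\<^sub>n\<^sub>+\<^sub>1\<close>,
  since otherwise it would decay like \<open>exp (- \<epsilon> 2^n)\<close>. From there on the linear parts dominate.
  Dividing them out turns the compositions into compositions of shears \<open>(x, y) \<mapsto> (x, y + b\<^sub>n x^2)\<close>
  with alternating coordinates and geometrically decreasing \<open>b\<^sub>n\<close>; these converge on the basin, and
  their inverses converge on the whole of \<open>\<complex>\<^sup>2\<close>.
\<close>

subsection \<open>Holomorphic maps of two variables\<close>

lemma clinear2_scale: "clinear2 L \<Longrightarrow> L (cscale2 a v) = cscale2 a (L v)"
  unfolding clinear2_def by blast

lemma clinear2_compose: "clinear2 L \<Longrightarrow> clinear2 M \<Longrightarrow> clinear2 (\<lambda>v. L (M v))"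
  using linear_compose[of M L] unfolding clinear2_def o_def by metis

lemma norm_cscale2: "norm (cscale2 a v) = cmod a * norm v"
  by (simp add: cscale2_def norm_prod_def norm_mult power_mult_distrib
      flip: distrib_left real_sqrt_mult) (simp add: real_sqrt_mult)

lemma continuous_on_cscale2 [continuous_intros]:
  "continuous_on S f \<Longrightarrow> continuous_on S g \<Longrightarrow> continuous_on S (\<lambda>x. cscale2 (f x) (g x))"
  unfolding cscale2_def by (intro continuous_intros)

lemma holo2_on_continuous: "holo2_on f U \<Longrightarrow> continuous_on U f"
  by (metis continuous_at_imp_continuous_on has_derivative_continuous holo2_on_def)

lemma holo2_on_compose:
  assumes "holo2_on f U" "holo2_on g V" "f ` U \<subseteq> V"
  shows "holo2_on (\<lambda>x. g (f x)) U"
  unfolding holo2_on_def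
proof
  fix x assume x: "x \<in> U"
  obtain L where L: "clinear2 L" "(f has_derivative L) (at x)"
    using assms(1) x unfolding holo2_on_def by blast
  obtain M where M: "clinear2 M" "(g has_derivative M) (at (f x))"
    using assms(2,3) x unfolding holo2_on_def by blast
  show "\<exists>N. clinear2 N \<and> ((\<lambda>x. g (f x)) has_derivative N) (at x)"
    using clinear2_compose[OF M(1) L(1)] diff_chain_at[OF L(2) M(2)] by (auto simp: o_def)
qed

lemma holo2_on_id: "holo2_on (\<lambda>x. x) U"
  unfolding holo2_on_def clinear2_def
  by (intro ballI exI[of _ "\<lambda>x. x"] conjI has_derivative_ident) (auto simp: linear_iff)

lemma holo2_on_scaleR: "holo2_on (\<lambda>x. r *\<^sub>R x) U"
  unfolding holo2_on_def clinear2_def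
  by (intro ballI exI[of _ "\<lambda>x. r *\<^sub>R x"] conjI has_derivative_scaleR_right has_derivative_ident)
     (auto simp: linear_iff cscale2_def algebra_simps)

lemma biholomorphic2I:
  assumes "open U" "open V" "holo2_on f U" "holo2_on g V"
    and "\<And>x. x \<in> U \<Longrightarrow> f x \<in> V" "\<And>y. y \<in> V \<Longrightarrow> g y \<in> U"
    and "\<And>x. x \<in> U \<Longrightarrow> g (f x) = x" "\<And>y. y \<in> V \<Longrightarrow> f (g y) = y"
  shows "biholomorphic2 U V"
proof -
  have "f ` U \<subseteq> V" "g ` V \<subseteq> U" using assms(5,6) by blast+
  moreover have "V \<subseteq> f ` U"
  proof
    fix y assume "y \<in> V"
    with assms(6,8) show "y \<in> f ` U" by (intro image_eqI[of y f "g y"]) simp_all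
  qed
  moreover have "U \<subseteq> g ` V"
  proof
    fix x assume "x \<in> U"
    with assms(5,7) show "x \<in> g ` V" by (intro image_eqI[of x g "f x"]) simp_all
  qed
  ultimately show ?thesis
    unfolding biholomorphic2_def using assms(1-4,7,8) by (intro conjI exI[of _ f] exI[of _ g] ballI equalityI)
qed

section \<open>Restriction to complex lines and the Cauchy estimate\<close>

text \<open>Reduces maps of two variables to one-variable complex analysis: as \<open>L\<close> is
  complex linear, the derivative along a complex line is multiplication by the entries of
  \<open>L v\<close>.\<close>

lemma has_field_derivative_along_line:
  assumes "(f has_derivative L) (at (p + cscale2 z v))" "clinear2 L"
  shows "((\<lambda>z. fst (f (p + cscale2 z v))) has_field_derivative fst (L v)) (at z)"
    and "((\<lambda>z. snd (f (p + cscale2 z v))) has_field_derivative snd (L v)) (at z)"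
proof -
  have "((\<lambda>z. p + cscale2 z v) has_derivative (\<lambda>h. cscale2 h v)) (at z)"
    unfolding cscale2_def by (auto intro!: derivative_eq_intros)
  from diff_chain_at[OF this assms(1)]
  have *: "((\<lambda>z. f (p + cscale2 z v)) has_derivative (\<lambda>h. cscale2 h (L v))) (at z)"
    by (simp add: o_def clinear2_scale[OF assms(2)])
  show "((\<lambda>z. fst (f (p + cscale2 z v))) has_field_derivative fst (L v)) (at z)"
    using has_derivative_fst[OF *]
    by (simp add: has_field_derivative_def cscale2_def mult.commute[of _ "fst (L v)"])
  show "((\<lambda>z. snd (f (p + cscale2 z v))) has_field_derivative snd (L v)) (at z)"
    using has_derivative_snd[OF *]
    by (simp add: has_field_derivative_def cscale2_def mult.commute[of _ "snd (L v)"])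
qed

lemma holomorphic_on_along_line:
  assumes "holo2_on f U" "\<And>z. z \<in> S \<Longrightarrow> p + cscale2 z v \<in> U"
  shows "(\<lambda>z. fst (f (p + cscale2 z v))) holomorphic_on S"
    and "(\<lambda>z. snd (f (p + cscale2 z v))) holomorphic_on S"
proof -
  have "\<exists>d. ((\<lambda>z. fst (f (p + cscale2 z v))) has_field_derivative d) (at z)"
       "\<exists>d. ((\<lambda>z. snd (f (p + cscale2 z v))) has_field_derivative d) (at z)" if "z \<in> S" for z
    using assms that has_field_derivative_along_line unfolding holo2_on_def by blast+
  then show "(\<lambda>z. fst (f (p + cscale2 z v))) holomorphic_on S"
    and "(\<lambda>z. snd (f (p + cscale2 z v))) holomorphic_on S"
    unfolding holomorphic_on_def field_differentiable_def
    by (meson has_field_derivative_at_within)+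
qed

text \<open>Cauchy's inequality for each component on the line through \<open>x\<close> in direction
  \<open>h\<close>. The factor 4 consists of 2 for using half the admissible radius and 2 for adding
  the two components.\<close>

lemma derivative_Cauchy_bound:
  assumes "r > 0" "holo2_on f (ball x r)" "\<And>y. y \<in> ball x r \<Longrightarrow> norm (f y) \<le> B"
    and L: "(f has_derivative L) (at x)" "clinear2 L"
  shows "norm (L h) \<le> 4 * B / r * norm h"
proof (cases "h = 0")
  case True
  then show ?thesis
    using has_derivative_linear[OF L(1)] by (simp add: linear_0)
next
  case False
  define \<rho> where "\<rho> = r / (2 * norm h)"
  have \<rho>: "\<rho> > 0" using False assms(1) by (simp add: \<rho>_def)
  have inb: "x + cscale2 z h \<in> ball x r" if "z \<in> cball 0 \<rho>" for z
  proof -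
    have "norm (cscale2 z h) \<le> \<rho> * norm h"
      using that by (auto simp: norm_cscale2 intro!: mult_right_mono)
    also have "\<dots> < r" using False assms(1) by (simp add: \<rho>_def)
    finally show ?thesis by (simp add: dist_norm)
  qed
  have eq: "4 * B / r * norm h = B / \<rho> + B / \<rho>"
    using False assms(1) by (simp add: \<rho>_def field_simps)
  have L': "(f has_derivative L) (at (x + cscale2 0 h))"
    using L by (simp add: cscale2_def zero_prod_def[symmetric])
  note hol = holomorphic_on_along_line[OF assms(2) inb, of "cball 0 \<rho>", simplified]
  have B: "cmod (fst (f (x + cscale2 z h))) \<le> B" "cmod (snd (f (x + cscale2 z h))) \<le> B"
    if "cmod (0 - z) = \<rho>" for z
    using assms(3)[OF inb, of z] that
      norm_fst_le[of "fst (f (x + cscale2 z h))" "snd (f (x + cscale2 z h))"]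
      norm_snd_le[of "snd (f (x + cscale2 z h))" "fst (f (x + cscale2 z h))"] by auto
  have "cmod ((deriv ^^ 1) (\<lambda>z. fst (f (x + cscale2 z h))) 0) \<le> fact 1 * B / \<rho> ^ 1"
    by (rule Cauchy_inequality[OF holomorphic_on_subset[OF hol(1)] holomorphic_on_imp_continuous_on[OF hol(1)] \<rho> B(1)])
      auto
  then have 1: "cmod (fst (L h)) \<le> B / \<rho>"
    by (simp add: DERIV_imp_deriv[OF has_field_derivative_along_line(1)[OF L' L(2)]])
  have "cmod ((deriv ^^ 1) (\<lambda>z. snd (f (x + cscale2 z h))) 0) \<le> fact 1 * B / \<rho> ^ 1"
    by (rule Cauchy_inequality[OF holomorphic_on_subset[OF hol(2)] holomorphic_on_imp_continuous_on[OF hol(2)] \<rho> B(2)])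
      auto
  then have 2: "cmod (snd (L h)) \<le> B / \<rho>"
    by (simp add: DERIV_imp_deriv[OF has_field_derivative_along_line(2)[OF L' L(2)]])
  show ?thesis
    using norm_Pair_le[of "fst (L h)" "snd (L h)"] 1 2 unfolding eq by simp
qed

section \<open>Uniform limits of holomorphic maps\<close>

text \<open>Weierstrass' theorem. Cauchy estimates on balls of half the radius make the derivatives
  uniformly Cauchy, so the limit can be differentiated termwise, and complex linearity passes to
  pointwise limits.\<close>

lemma holo2_uniform_limit_at:
  assumes "d > 0" and holo: "\<And>n. holo2_on (f n) (ball x0 d)"
    and lim: "uniform_limit (ball x0 d) f g sequentially"
  shows "\<exists>L. clinear2 L \<and> (g has_derivative L) (at x0)"
proof -
  define S where "S = ball x0 (d/2)"
  have sub: "ball x (d/2) \<subseteq> ball x0 d" if "x \<in> S" for x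
  proof
    fix y assume "y \<in> ball x (d/2)"
    then show "y \<in> ball x0 d"
      using that dist_triangle[of x0 y x] unfolding S_def by auto
  qed
  have xS: "x0 \<in> S" using assms(1) by (simp add: S_def)
  have ex: "\<exists>L. clinear2 L \<and> (f n has_derivative L) (at x)" if "x \<in> S" for n x
  proof -
    have "x \<in> ball x0 d" using that assms(1) unfolding S_def by auto
    then show ?thesis using holo[of n] unfolding holo2_on_def by blast
  qed
  define f' where "f' n x = (SOME L. clinear2 L \<and> (f n has_derivative L) (at x))" for n x
  have f': "clinear2 (f' n x)" "(f n has_derivative f' n x) (at x)" if "x \<in> S" for n x
    using someI_ex[OF ex[OF that]] unfolding f'_def by blast+
  have Cau: "\<exists>N. \<forall>m\<ge>N. \<forall>n\<ge>N. \<forall>x\<in>S. \<forall>h. norm (f' m x h - f' n x h) \<le> e * norm h" if "e > 0" for e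
  proof -
    \<comment> \<open>Chosen so that the Cauchy bound \<open>4 * B / (d/2)\<close> for radius
      \<open>d/2\<close> equals \<open>e\<close>.\<close>
    define B where "B = e * d / 8"
    have B: "B > 0" using that assms(1) by (simp add: B_def)
    have "uniformly_Cauchy_on (ball x0 d) f"
      using lim uniformly_convergent_Cauchy uniformly_convergent_on_def by blast
    then obtain N where N: "\<And>x m n. x \<in> ball x0 d \<Longrightarrow> m \<ge> N \<Longrightarrow> n \<ge> N \<Longrightarrow> dist (f m x) (f n x) < B"
      using B unfolding uniformly_Cauchy_on_def by meson
    have "norm (f' m x h - f' n x h) \<le> e * norm h" if mn: "m \<ge> N" "n \<ge> N" and x: "x \<in> S" for m n x h
    proof -
      have "norm (f' m x h - f' n x h) \<le> 4 * B / (d/2) * norm h"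
      proof (rule derivative_Cauchy_bound)
        show "0 < d/2" using assms(1) by simp
        have *: "clinear2 (\<lambda>h. L h - M h)" if "clinear2 L" "clinear2 M" for L M
          using that unfolding clinear2_def
          by (auto intro: linear_compose_sub) (simp add: cscale2_def algebra_simps)
        show "holo2_on (\<lambda>x. f m x - f n x) (ball x (d / 2))"
          unfolding holo2_on_def
        proof
          fix y assume "y \<in> ball x (d/2)"
          then have "y \<in> ball x0 d" using sub[OF x] by blast
          then obtain L M where "clinear2 L" "(f m has_derivative L) (at y)"
            "clinear2 M" "(f n has_derivative M) (at y)"
            using holo unfolding holo2_on_def by meson
          then show "\<exists>L. clinear2 L \<and> ((\<lambda>x. f m x - f n x) has_derivative L) (at y)"
            by (intro exI[of _ "\<lambda>h. L h - M h"] conjI * has_derivative_diff)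
        qed
        show "norm (f m y - f n y) \<le> B" if "y \<in> ball x (d/2)" for y
          using N[of y m n] that sub[OF x] mn by (force simp: dist_norm)
        show "((\<lambda>x. f m x - f n x) has_derivative (\<lambda>h. f' m x h - f' n x h)) (at x)"
          using f'(2)[OF x] by (intro has_derivative_diff)
        show "clinear2 (\<lambda>h. f' m x h - f' n x h)" using * f'(1)[OF x] by blast
      qed
      then show ?thesis using assms(1) by (simp add: B_def field_simps)
    qed
    then show ?thesis by blast
  qed
  define g' where "g' x h = lim (\<lambda>n. f' n x h)" for x h
  have g': "(\<lambda>n. f' n x h) \<longlonglongrightarrow> g' x h" if "x \<in> S" for x h
  proof -
    have "Cauchy (\<lambda>n. f' n x h)"
    proof (rule metric_CauchyI)
      fix e :: real assume "e > 0"
      then have e: "e / (norm h + 1) > 0" by (simp add: add_nonneg_pos)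
      have "e / (norm h + 1) * norm h < e"
        using \<open>e > 0\<close> pos_divide_less_eq[of "norm h + 1" "e * norm h" e]
          add_nonneg_pos[OF norm_ge_zero zero_less_one, of h]
        by (simp add: algebra_simps)
      with Cau[OF e] show "\<exists>M. \<forall>m\<ge>M. \<forall>n\<ge>M. dist (f' m x h) (f' n x h) < e"
        using that unfolding dist_norm by (meson le_less_trans)
    qed
    then show ?thesis unfolding g'_def by (simp add: Cauchy_convergent_iff convergent_LIMSEQ_iff)
  qed
  have "clinear2 (g' x0)"
  proof -
    have lin: "linear (f' n x0)" for n using f'(1)[OF xS] by (simp add: clinear2_def)
    have "g' x0 (u + v) = g' x0 u + g' x0 v" for u v
      using LIMSEQ_unique[OF g'[OF xS, of "u+v"], of "g' x0 u + g' x0 v"]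
        tendsto_add[OF g'[OF xS] g'[OF xS], of u v] by (simp add: linear_add[OF lin])
    moreover have "g' x0 (r *\<^sub>R u) = r *\<^sub>R g' x0 u" for r u
      using LIMSEQ_unique[OF g'[OF xS, of "r *\<^sub>R u"], of "r *\<^sub>R g' x0 u"]
        tendsto_scaleR[OF tendsto_const g'[OF xS], of r u] by (simp add: linear_scale[OF lin])
    moreover have "g' x0 (cscale2 r u) = cscale2 r (g' x0 u)" for r u
    proof -
      have "(\<lambda>n. cscale2 r (f' n x0 u)) \<longlonglongrightarrow> cscale2 r (g' x0 u)"
        unfolding cscale2_def by (intro tendsto_intros g'[OF xS])
      then show ?thesis
        using LIMSEQ_unique[OF g'[OF xS, of "cscale2 r u"]] 
        by (simp add: clinear2_scale[OF f'(1)[OF xS]])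
    qed
    ultimately show ?thesis by (simp add: clinear2_def linear_iff)
  qed
  moreover have "\<exists>G. \<forall>x\<in>S. (\<lambda>n. f n x) \<longlonglongrightarrow> G x \<and> (G has_derivative g' x) (at x within S)"
  proof (rule has_derivative_sequence)
    show "convex S" by (simp add: S_def)
    show "(f n has_derivative f' n x) (at x within S)" if "x \<in> S" for n x
      using f'(2)[OF that] has_derivative_at_withinI by blast
    show "\<forall>\<^sub>F n in sequentially. \<forall>x\<in>S. \<forall>h. norm (f' n x h - g' x h) \<le> e * norm h" if e: "e > 0" for e
    proof -
      obtain N where N: "\<And>m n x h. m\<ge>N \<Longrightarrow> n\<ge>N \<Longrightarrow> x\<in>S \<Longrightarrow> norm (f' m x h - f' n x h) \<le> e * norm h"
        using Cau[OF e] by blast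
      have "norm (f' n x h - g' x h) \<le> e * norm h" if "n \<ge> N" "x \<in> S" for n x h
      proof (rule tendsto_upperbound[where F=sequentially])
        show "(\<lambda>m. norm (f' n x h - f' m x h)) \<longlonglongrightarrow> norm (f' n x h - g' x h)"
          by (intro tendsto_intros g' that)
        show "\<forall>\<^sub>F m in sequentially. norm (f' n x h - f' m x h) \<le> e * norm h"
          using eventually_ge_at_top[of N] by eventually_elim (use N that in blast)
      qed simp
      then show ?thesis using eventually_sequentially by blast
    qed
    show "x0 \<in> S" by (rule xS)
    show "(\<lambda>n. f n x0) \<longlonglongrightarrow> g x0"
      by (rule tendsto_uniform_limitI[OF lim]) (use assms(1) in simp)
  qed
  then obtain G where G: "\<And>x. x \<in> S \<Longrightarrow> (\<lambda>n. f n x) \<longlonglongrightarrow> G x"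
    "\<And>x. x \<in> S \<Longrightarrow> (G has_derivative g' x) (at x within S)" by blast
  \<comment> \<open>Termwise differentiation provides some pointwise limit \<open>G\<close>;
    uniqueness of limits identifies it with \<open>g\<close> on \<open>S\<close>.\<close>
  have "G x = g x" if "x \<in> S" for x
  proof -
    have "x \<in> ball x0 d" using that assms(1) by (auto simp: S_def)
    then show ?thesis by (rule LIMSEQ_unique[OF G(1)[OF that] tendsto_uniform_limitI[OF lim]])
  qed
  then have "(g has_derivative g' x0) (at x0 within S)"
    using G(2)[OF xS] has_derivative_transform[OF xS, of g G] by simp
  then have "(g has_derivative g' x0) (at x0)"
    using xS by (simp add: S_def at_within_open[of x0 "ball x0 (d/2)"])
  ultimately show ?thesis by blast
qed

text \<open>The M-test for the telescoping series of increments. The limit is expressed by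
  \<open>lim\<close> to match the definitions of the limit maps further down.\<close>

lemma uniform_limit_increments:
  fixes f :: "nat \<Rightarrow> 'a \<Rightarrow> 'b::banach" and A :: "'a set"
  assumes "\<And>n x. n \<ge> N \<Longrightarrow> x \<in> A \<Longrightarrow> norm (f (Suc n) x - f n x) \<le> (M n :: real)" "summable M"
  shows "uniform_limit A f (\<lambda>x. lim (\<lambda>n. f n x)) sequentially"
proof -
  have "uniform_limit A (\<lambda>n x. \<Sum>i<n. f (Suc i) x - f i x)
          (\<lambda>x. suminf (\<lambda>i. f (Suc i) x - f i x)) sequentially"
    using assms by (intro Weierstrass_m_test_ev) (auto simp: eventually_sequentially)
  then have "uniform_limit A (\<lambda>n x. (\<Sum>i<n. f (Suc i) x - f i x) + f 0 x)
      (\<lambda>x. suminf (\<lambda>i. f (Suc i) x - f i x) + f 0 x) sequentially"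
    by (intro uniform_limit_intros)
  then   have *: "uniform_limit A f (\<lambda>x. suminf (\<lambda>i. f (Suc i) x - f i x) + f 0 x) sequentially"
    by (simp add: sum_lessThan_telescope[of "\<lambda>n. f n x" for x])
  show ?thesis
    by (rule uniform_limit_cong'[THEN iffD1, OF _ _ *])
       (use tendsto_uniform_limitI[OF *] in \<open>auto intro!: limI[symmetric]\<close>)
qed

subsection \<open>Means over circles\<close>

text \<open>The product of \<open>f\<close> over all rotations by the \<open>N\<close>-th roots of unity is holomorphic, so its
  modulus is somewhere on the circle at least as large as at the origin.\<close>

lemma roots_unity_product_bound:
  fixes f :: "complex \<Rightarrow> complex"
  assumes f: "f holomorphic_on UNIV" and N: "N > 0"
  obtains \<theta> where "0 \<le> \<theta>" "\<theta> < 2 * pi / real N"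
    "cmod (f 0) ^ N \<le> (\<Prod>j<N. cmod (f (cis (\<theta> + 2 * pi * real j / real N))))"
proof -
  define g where "g z = (\<Prod>j<N. f (cis (2 * pi * real j / real N) * z))" for z
  have g: "g z = (\<Prod>\<omega>\<in>{\<omega>. \<omega> ^ N = 1}. f (\<omega> * z))" for z
    unfolding g_def using prod.reindex_bij_betw[OF Complex.bij_betw_roots_unity[OF N], of "\<lambda>\<omega>. f (\<omega> * z)"] .
  have "(\<lambda>z. f (a * z)) holomorphic_on UNIV" for a
    using holomorphic_on_compose_gen[OF _ f, of "\<lambda>z. a * z"] by (auto simp: o_def intro!: holomorphic_intros)
  then have holg: "g holomorphic_on UNIV"
    unfolding g_def by (intro holomorphic_intros)
  then have contg: "continuous_on S g" for S
    using holomorphic_on_imp_continuous_on continuous_on_subset by blast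
  have "compact (sphere (0::complex) 1)" "sphere (0::complex) 1 \<noteq> {}" by auto
  then obtain \<xi> where \<xi>: "\<xi> \<in> sphere 0 1" "\<And>z. z \<in> sphere 0 1 \<Longrightarrow> cmod (g z) \<le> cmod (g \<xi>)"
    using continuous_attains_sup[OF _ _ continuous_on_norm[OF contg[of "sphere 0 1"]]]
    by metis
  have max: "cmod (g 0) \<le> cmod (g \<xi>)"
    by (rule maximum_modulus_frontier[of g "cball 0 1"])
       (use holg \<xi>(2) contg in \<open>auto intro: holomorphic_on_subset\<close>)
  have "cmod \<xi> = 1" using \<xi>(1) by auto
  then obtain \<theta>0 where \<theta>0: "0 \<le> \<theta>0" "\<xi> = cis \<theta>0"
    by (metis Arg2pi_ge_0 cis_conv_exp complex_norm_eq_1_exp)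
  \<comment> \<open>The angle of the maximum point is reduced modulo \<open>2 * pi / N\<close>. This
    leaves the value of \<open>g\<close> unchanged, since rotation by an \<open>N\<close>-th root of
    unity permutes its factors.\<close>
  define k where "k = nat \<lfloor>\<theta>0 / (2 * pi / real N)\<rfloor>"
  have k: "real k \<le> \<theta>0 / (2 * pi / real N)" "\<theta>0 / (2 * pi / real N) < real k + 1"
    using \<theta>0(1) by (auto simp: k_def)
  define \<theta> where "\<theta> = \<theta>0 - 2 * pi * k / N"
  have \<theta>: "0 \<le> \<theta>" "\<theta> < 2 * pi / real N"
  proof -
    have p: "2 * pi / real N > 0" using N by simp
    show "0 \<le> \<theta>" "\<theta> < 2 * pi / real N"
      using k unfolding pos_le_divide_eq[OF p] pos_divide_less_eq[OF p]
      by (simp_all add: \<theta>_def algebra_simps add_divide_distrib)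
  qed
  define \<rho> where "\<rho> = cis (2 * pi * k / N)"
  have \<rho>: "\<rho> ^ N = 1" "\<rho> \<noteq> 0"
  proof -
    have "\<rho> ^ N = cis (2 * pi * real k)" using N by (simp add: \<rho>_def Complex.DeMoivre)
    then show "\<rho> ^ N = 1" using cis_multiple_2pi[of "real k"] by simp
  qed (simp add: \<rho>_def)
  have "\<xi> = \<rho> * cis \<theta>"
    by (simp add: \<theta>0(2) \<theta>_def \<rho>_def cis_mult)
  then have "g \<xi> = (\<Prod>\<omega>\<in>{\<omega>. \<omega> ^ N = 1}. f (\<omega> * \<rho> * cis \<theta>))"
    by (simp add: g mult.assoc)
  also have "\<dots> = (\<Prod>\<omega>\<in>{\<omega>. \<omega> ^ N = 1}. f (\<omega> * cis \<theta>))"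
    by (rule prod.reindex_bij_witness[of _ "\<lambda>w. w / \<rho>" "\<lambda>w. w * \<rho>"])
       (use \<rho> in \<open>auto simp: power_mult_distrib power_divide\<close>)
  finally have "g \<xi> = (\<Prod>j<N. f (cis (\<theta> + 2 * pi * real j / real N)))"
    by (simp add: g[symmetric] g_def cis_mult add.commute)
  moreover have "g 0 = f 0 ^ N" by (simp add: g_def)
  ultimately show thesis
    using max that[OF \<theta>] by (simp add: norm_power prod_norm)
qed

text \<open>Serves to pass from equally spaced points to the whole circle; \<open>\<epsilon>\<close>
  stands for the oscillation of \<open>H\<close> on one cell.\<close>

lemma riemann_sum_le_integral:
  fixes H :: "real \<Rightarrow> real"
  assumes "continuous_on UNIV H" "s > 0"
    and "\<And>x j. j < n \<Longrightarrow> real j * s \<le> x \<Longrightarrow> x \<le> real (Suc j) * s \<Longrightarrow> y j - \<epsilon> \<le> H x"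
  shows "(\<Sum>j<n. s * (y j - \<epsilon>)) \<le> integral {0..real n * s} H"
  using assms(3)
proof (induction n)
  case 0
  then show ?case by simp
next
  case (Suc n)
  have int: "H integrable_on {a..b}" for a b
    using assms(1) continuous_on_subset integrable_continuous_real by blast
  have "s * (y n - \<epsilon>) = integral {real n * s..real (Suc n) * s} (\<lambda>x. y n - \<epsilon>)"
    using assms(2) by (simp add: algebra_simps)
  also have "\<dots> \<le> integral {real n * s..real (Suc n) * s} H"
    by (rule integral_le) (use Suc.prems int in auto)
  also have "(\<Sum>j<n. s * (y j - \<epsilon>)) + \<dots>
      \<le> integral {0..real n * s} H + integral {real n * s..real (Suc n) * s} H"
    using Suc by simp
  also have "\<dots> = integral {0..real (Suc n) * s} H"
    using assms(2) by (intro Henstock_Kurzweil_Integration.integral_combine int) (auto simp: algebra_simps)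
  finally show ?case by simp
qed

text \<open>The submean inequality for \<open>ln (cmod (f z))\<close>, with a continuous majorant
  \<open>h\<close> in its place so that zeros of \<open>f\<close> cause no trouble. The product over
  \<open>N\<close> equally spaced points is at most the exponential of \<open>N\<close> times a
  discrete mean of \<open>h\<close>; an \<open>N\<close>-th root and refinement give the
  integral.\<close>

lemma holomorphic_log_majorant_mean:
  fixes h :: "complex \<Rightarrow> real"
  assumes f: "f holomorphic_on UNIV" and h: "continuous_on UNIV h"
    and fh: "\<And>z. cmod z = 1 \<Longrightarrow> cmod (f z) \<le> exp (h z)"
  shows "cmod (f 0) \<le> exp (integral {0..2*pi} (\<lambda>\<theta>. h (cis \<theta>)) / (2 * pi))"
proof -
  define H where "H = (\<lambda>\<theta>. h (cis \<theta>))"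
  define I where "I = integral {0..2*pi} H"
  have H: "continuous_on UNIV H"
    unfolding H_def by (intro continuous_on_compose2[OF h] continuous_intros) auto
  have main: "cmod (f 0) \<le> exp (I / (2 * pi) + \<epsilon>)" if "\<epsilon> > 0" for \<epsilon>
  proof -
    have "uniformly_continuous_on {0..2*pi} H"
      using H by (intro compact_uniformly_continuous) (auto intro: continuous_on_subset)
    then obtain \<delta> where \<delta>: "\<delta> > 0"
      "\<And>x y. x \<in> {0..2*pi} \<Longrightarrow> y \<in> {0..2*pi} \<Longrightarrow> dist y x < \<delta> \<Longrightarrow> dist (H y) (H x) < \<epsilon>"
      using \<open>\<epsilon> > 0\<close> unfolding uniformly_continuous_on_def by metis
    obtain N where N: "2 * pi / \<delta> < real N" using reals_Archimedean2 by blast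
    moreover have "0 < 2 * pi / \<delta>" using \<delta>(1) by simp
    ultimately have "0 < real N" by linarith
    then have N0: "N > 0" by simp
    define s where "s = 2 * pi / real N"
    have s: "s > 0" "N * s = 2 * pi" "s < \<delta>"
      using N0 by (simp_all add: s_def)
        (use N N0 \<delta>(1) in \<open>simp add: pos_divide_less_eq mult.commute\<close>)
    from roots_unity_product_bound[OF f N0]
    obtain \<theta> where \<theta>: "0 \<le> \<theta>" "\<theta> < 2 * pi / real N"
      and prod: "cmod (f 0) ^ N \<le> (\<Prod>j<N. cmod (f (cis (\<theta> + 2 * pi * real j / real N))))" .
    note \<theta>(2)[folded s_def]
    note \<theta> = \<theta>(1) this
    define y where "y j = H (\<theta> + j * s)" for j :: nat
    have "cmod (f 0) ^ N \<le> (\<Prod>j<N. exp (y j))"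
    proof (rule order_trans[OF prod], rule prod_mono)
      fix j
      show "0 \<le> cmod (f (cis (\<theta> + 2 * pi * real j / real N))) \<and> cmod (f (cis (\<theta> + 2 * pi * real j / real N))) \<le> exp (y j)"
        using fh[of "cis (\<theta> + 2 * pi * real j / real N)"] by (simp add: y_def H_def s_def mult_ac)
    qed
    then have 1: "cmod (f 0) ^ N \<le> exp (\<Sum>j<N. y j)"
      by (simp add: exp_sum)
    have "(\<Sum>j<N. s * (y j - \<epsilon>)) \<le> integral {0..N * s} H"
    proof (rule riemann_sum_le_integral[OF H s(1)])
      fix x j assume j: "j < N" "real j * s \<le> x" "x \<le> real (Suc j) * s"
      have "real (Suc j) * s \<le> real N * s"
        using j(1) s(1) by (intro mult_right_mono) auto
      then have le: "real (Suc j) * s \<le> 2 * pi" using s(2) by simp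
      have "0 \<le> real j * s" using s(1) by simp
      then have "0 \<le> x" using j(2) by linarith
      \<comment> \<open>Both \<open>x\<close> and \<open>\<theta> + j * s\<close> lie in the
        \<open>j\<close>-th cell, whose length \<open>s\<close> is below \<open>\<delta>\<close> and
        which is contained in \<open>{0..2*pi}\<close>.\<close>
      then have "dist (H (\<theta> + j * s)) (H x) < \<epsilon>"
        using j le \<theta> s by (intro \<delta>(2)) (auto simp: dist_real_def algebra_simps)
      then show "y j - \<epsilon> \<le> H x" by (simp add: y_def dist_real_def)
    qed
    then have "s * (\<Sum>j<N. y j) - 2 * pi * \<epsilon> \<le> I"
      using s(2) by (simp add: I_def sum_distrib_left[symmetric] sum_subtractf algebra_simps)
    then have "(\<Sum>j<N. y j) \<le> N * (I / (2 * pi) + \<epsilon>)"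
      using s(1) N0 by (simp add: s_def field_simps)
    then have "cmod (f 0) ^ N \<le> exp (I / (2 * pi) + \<epsilon>) ^ N"
      using 1 by (simp add: exp_of_nat_mult[symmetric]) (meson exp_le_cancel_iff order_trans)
    then show ?thesis
      using N0 by (simp add: power_mono_iff)
  qed
  have "(\<lambda>n. exp (I / (2 * pi) + inverse (real (Suc n)))) \<longlonglongrightarrow> exp (I / (2 * pi) + 0)"
    by (intro tendsto_intros LIMSEQ_inverse_real_of_nat)
  then have "cmod (f 0) \<le> exp (I / (2 * pi) + 0)"
    by (rule tendsto_lowerbound) (use main in \<open>auto simp del: of_nat_Suc\<close>)
  then show ?thesis by (simp add: I_def H_def)
qed

section \<open>Circle means as ordinary integrals\<close>

lemma nn_integral_max_real:
  fixes w :: "real \<Rightarrow> real"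
  assumes "set_integrable lborel {a..b} w"
  shows "(\<integral>\<^sup>+ \<theta>. e2ennreal (max (ereal (w \<theta>)) 0) * indicator {a..b} \<theta> \<partial>lborel)
     = ennreal (LINT \<theta>:{a..b}|lborel. max (w \<theta>) 0)"
proof -
  have eq: "e2ennreal (max (ereal (w \<theta>)) 0) * indicator {a..b} \<theta>
      = ennreal (indicator {a..b} \<theta> *\<^sub>R max (w \<theta>) 0)" for \<theta>
  proof -
    have "e2ennreal (max (ereal (w \<theta>)) 0) = ennreal (max (w \<theta>) 0)"
      unfolding zero_ereal_def ereal_max[symmetric] by (rule e2ennreal_ereal)
    then show ?thesis by (simp split: split_indicator)
  qed
  have "(\<lambda>\<theta>. indicator {a..b} \<theta> *\<^sub>R max (w \<theta>) 0) = (\<lambda>\<theta>. max (indicator {a..b} \<theta> *\<^sub>R w \<theta>) 0)"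
    by (auto split: split_indicator)
  then have "integrable lborel (\<lambda>\<theta>. indicator {a..b} \<theta> *\<^sub>R max (w \<theta>) 0)"
    using assms unfolding set_integrable_def by simp
  then show ?thesis
    unfolding eq set_lebesgue_integral_def by (intro nn_integral_eq_integral) auto
qed

text \<open>For an integrable real function the positive and negative parts both have finite
  integral, so the extended difference is the ordinary integral.\<close>

lemma circle_mean_real:
  assumes "set_integrable lborel {0..2*pi} (\<lambda>\<theta>. w (a + cscale2 (cis \<theta>) b))"
  shows "circle_mean (\<lambda>p. ereal (w p)) a b
     = ereal ((LINT \<theta>:{0..2*pi}|lborel. w (a + cscale2 (cis \<theta>) b)) / (2 * pi))"
proof -
  define g where "g \<theta> = w (a + cscale2 (cis \<theta>) b)" for \<theta>
  have g: "set_integrable lborel {0..2*pi} g" using assms by (simp add: g_def[abs_def])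
  have g': "set_integrable lborel {0..2*pi} (\<lambda>\<theta>. - g \<theta>)"
    using g by (simp add: set_integrable_def)
  have m: "set_integrable lborel {0..2*pi} (\<lambda>\<theta>. max (h \<theta>) 0)"
    if "set_integrable lborel {0..2*pi} h" for h :: "real \<Rightarrow> real"
  proof -
    have "(\<lambda>\<theta>. indicator {0..2*pi} \<theta> *\<^sub>R max (h \<theta>) 0) = (\<lambda>\<theta>. max (indicator {0..2*pi} \<theta> *\<^sub>R h \<theta>) 0)"
      by (auto split: split_indicator)
    then show ?thesis using that unfolding set_integrable_def by simp
  qed
  have nn: "0 \<le> (LINT \<theta>:{0..2*pi}|lborel. max (h \<theta>) (0::real))" for h
    unfolding set_lebesgue_integral_def by (intro integral_nonneg_AE) auto
  have "(LINT \<theta>:{0..2*pi}|lborel. max (g \<theta>) 0) - (LINT \<theta>:{0..2*pi}|lborel. max (- g \<theta>) 0)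
      = (LINT \<theta>:{0..2*pi}|lborel. max (g \<theta>) 0 - max (- g \<theta>) 0)"
    by (rule set_integral_diff(2)[symmetric, OF m[OF g] m[OF g']])
  also have "\<dots> = (LINT \<theta>:{0..2*pi}|lborel. g \<theta>)"
    by (intro set_lebesgue_integral_cong) (auto simp: max_def)
  finally show ?thesis
    using nn_integral_max_real[OF g] nn_integral_max_real[OF g'] nn[of g] nn[of "\<lambda>\<theta>. - g \<theta>"]
    by (simp add: circle_mean_def Let_def g_def[symmetric] enn2ereal_ennreal)
qed

subsection \<open>The maps, their compositions and the Kobayashi--Royden metric\<close>

definition hmap :: "real \<Rightarrow> c2 \<Rightarrow> c2" where
  "hmap a p = ((fst p)\<^sup>2 + of_real a * snd p, of_real a * fst p)"

definition hinv :: "real \<Rightarrow> c2 \<Rightarrow> c2" where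
  "hinv a p = (snd p / of_real a, (fst p - (snd p / of_real a)\<^sup>2) / of_real a)"

text \<open>Coefficients are indexed from 0: \<open>a n\<close> belongs to the map with number
  \<open>Suc n\<close>.\<close>

primrec hcomp :: "(nat \<Rightarrow> real) \<Rightarrow> nat \<Rightarrow> c2 \<Rightarrow> c2" where
  "hcomp a 0 p = p"
| "hcomp a (Suc n) p = hmap (a n) (hcomp a n p)"

primrec hcinv :: "(nat \<Rightarrow> real) \<Rightarrow> nat \<Rightarrow> c2 \<Rightarrow> c2" where
  "hcinv a 0 p = p"
| "hcinv a (Suc n) p = hcinv a n (hinv (a n) p)"

text \<open>The derivative of \<open>hcomp a n\<close> at \<open>p\<close>, unrolled by the chain
  rule so that it can be estimated along an orbit.\<close>

primrec hderiv :: "(nat \<Rightarrow> real) \<Rightarrow> nat \<Rightarrow> c2 \<Rightarrow> c2 \<Rightarrow> c2" where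
  "hderiv a 0 p v = v"
| "hderiv a (Suc n) p v =
    (2 * fst (hcomp a n p) * fst (hderiv a n p v) + of_real (a n) * snd (hderiv a n p v),
     of_real (a n) * fst (hderiv a n p v))"

definition hbasin :: "(nat \<Rightarrow> real) \<Rightarrow> c2 set" where
  "hbasin a = {p. (\<lambda>n. hcomp a n p) \<longlonglongrightarrow> 0}"

text \<open>Solving \<open>c powr (t ^ n) = exp (- s)\<close> gives the \<open>n\<close>-th root of
  \<open>s / (- ln c)\<close>. The constant \<open>- ln c\<close> is invisible in the limit because
  its \<open>n\<close>-th root tends to 1.\<close>

lemma exponents_for_basin:
  fixes c :: real
  assumes c: "0 < c" "c < 1" and s: "\<And>n. s n > 0"
    and lim: "(\<lambda>n. s n powr (1 / Suc n)) \<longlonglongrightarrow> 2"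
  obtains t where "\<forall>n\<ge>1. t n > 0" "t \<longlonglongrightarrow> 2" "basin c t = hbasin (\<lambda>n. exp (- s n))"
proof -
  define l where "l = - ln c"
  have l: "l > 0" using c by (simp add: l_def)
  \<comment> \<open>The shift reconciles \<open>t\<close>, indexed from 1, with \<open>s\<close>,
    indexed from 0.\<close>
  define t where "t n = (s (n - 1) / l) powr (1 / n)" for n
  have t: "t (Suc n) = s n powr (1 / Suc n) * (1 / l) powr (1 / Suc n)" for n
    using s[of n] l by (simp add: t_def divide_inverse powr_mult)
  have "(\<lambda>n. (1 / l) powr (1 / Suc n)) \<longlonglongrightarrow> (1 / l) powr 0"
    using l by (intro tendsto_powr tendsto_const LIMSEQ_Suc[OF lim_1_over_n]) auto
  with lim have "(\<lambda>n. s n powr (1 / Suc n) * (1 / l) powr (1 / Suc n)) \<longlonglongrightarrow> 2 * (1 / l) powr 0"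
    by (intro tendsto_mult)
  then have "(\<lambda>n. t (Suc n)) \<longlonglongrightarrow> 2" using l by (simp add: t)
  then have "t \<longlonglongrightarrow> 2" by (rule LIMSEQ_imp_Suc)
  moreover have "\<forall>n\<ge>1. t n > 0"
    using s l by (simp add: t_def less_imp_neq[symmetric])
  moreover have "basin c t = hbasin (\<lambda>n. exp (- s n))"
  proof -
    have "t (Suc n) ^ Suc n = s n / l" for n
    proof -
      have "t (Suc n) ^ Suc n = t (Suc n) powr real (Suc n)"
        using s[of n] l by (intro powr_realpow[symmetric]) (simp add: t_def less_imp_neq)
      also have "\<dots> = s n / l"
        using s[of n] l by (simp add: t_def powr_powr del: of_nat_Suc)
      finally show ?thesis .
    qed
    then have a: "c powr (t (Suc n) ^ Suc n) = exp (- s n)" for n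
      using c l by (simp add: powr_def l_def del: power_Suc)
    have "Fcomp c t n p = hcomp (\<lambda>n. exp (- s n)) n p" for n p
      by (induction n) (simp_all add: Fmap_def hmap_def Let_def a del: power_Suc)
    then show ?thesis by (simp add: basin_def hbasin_def)
  qed
  ultimately show thesis using that by blast
qed

section \<open>Basic properties of the maps and their iterates\<close>

lemma norm_Pair_zero: "norm (x, 0) = norm x"
  by (simp add: norm_Pair)

lemma norm_swap: "norm (snd p, fst p) = norm (p :: c2)"
  by (simp add: norm_prod_def add.commute)

text \<open>The map is \<open>(z^2, 0)\<close> plus \<open>a\<close> times the coordinate swap, and
  the swap is an isometry.\<close>

lemma norm_hmap:
  assumes "a \<ge> 0"
  shows "norm (hmap a p) \<le> norm p ^ 2 + a * norm p"
proof -
  have "hmap a p = ((fst p)\<^sup>2, 0) + cscale2 (of_real a) (snd p, fst p)"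
    by (simp add: hmap_def cscale2_def)
  then have "norm (hmap a p) \<le> norm ((fst p)\<^sup>2, 0::complex) + norm (cscale2 (of_real a) (snd p, fst p))"
    by (metis norm_triangle_ineq)
  also have "\<dots> = cmod (fst p) ^ 2 + a * norm p"
    using assms by (simp add: norm_cscale2 norm_swap norm_Pair_zero norm_power)
  also have "\<dots> \<le> norm p ^ 2 + a * norm p"
    using norm_fst_le[of "fst p" "snd p"] by (simp add: power_mono)
  finally show ?thesis .
qed

lemma hmap_has_derivative:
  "(hmap a has_derivative (\<lambda>v. (2 * fst p * fst v + of_real a * snd v, of_real a * fst v))) (at p)"
  unfolding hmap_def by (auto intro!: derivative_eq_intros simp: algebra_simps)

lemma holo2_on_hmap: "holo2_on (hmap a) U"
  unfolding holo2_on_def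
proof
  fix p
  show "\<exists>L. clinear2 L \<and> (hmap a has_derivative L) (at p)"
    unfolding clinear2_def
    by (rule exI, intro conjI, rule has_derivative_linear, rule hmap_has_derivative[of a p])
       (auto simp: cscale2_def algebra_simps intro: hmap_has_derivative[of a p, simplified])
qed

lemma holo2_on_hinv:
  assumes "a \<noteq> 0"
  shows "holo2_on (hinv a) U"
  unfolding holo2_on_def
proof
  fix p
  have d: "(hinv a has_derivative (\<lambda>v. (snd v / of_real a,
      (fst v - 2 * (snd p / of_real a) * (snd v / of_real a)) / of_real a))) (at p)"
    unfolding hinv_def divide_inverse by (auto intro!: derivative_eq_intros
        simp: algebra_simps power2_eq_square)
  show "\<exists>L. clinear2 L \<and> (hinv a has_derivative L) (at p)"
    unfolding clinear2_def
    by (rule exI, intro conjI, rule has_derivative_linear, rule d)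
       (use assms d in \<open>auto simp: cscale2_def field_simps\<close>)
qed

lemma hmap_hinv: "a \<noteq> 0 \<Longrightarrow> hmap a (hinv a p) = p"
  by (cases p) (simp add: hmap_def hinv_def)

lemma hinv_hmap: "a \<noteq> 0 \<Longrightarrow> hinv a (hmap a p) = p"
  by (cases p) (simp add: hmap_def hinv_def)

lemma holo2_on_hcomp: "holo2_on (hcomp a n) U"
proof (induction n)
  case 0
  then show ?case using holo2_on_id by simp
next
  case (Suc n)
  then show ?case
    using holo2_on_compose[OF Suc holo2_on_hmap[of "a n" UNIV]] by simp
qed

lemma holo2_on_hcinv:
  assumes "\<And>n. a n > 0"
  shows "holo2_on (hcinv a n) U"
proof (induction n arbitrary: U)
  case 0
  then show ?case using holo2_on_id by simp
next
  case (Suc n)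
  have "a n \<noteq> 0" using assms[of n] by simp
  then show ?case
    using holo2_on_compose[OF holo2_on_hinv Suc[of UNIV]] by simp
qed

lemma hcomp_hcinv: "(\<And>n. a n > 0) \<Longrightarrow> hcomp a n (hcinv a n p) = p"
  by (induction n arbitrary: p) (auto simp: hmap_hinv less_imp_neq[THEN not_sym])

lemma hcinv_hcomp: "(\<And>n. a n > 0) \<Longrightarrow> hcinv a n (hcomp a n p) = p"
  by (induction n arbitrary: p) (auto simp: hinv_hmap less_imp_neq[THEN not_sym])

lemma continuous_on_hcomp: "continuous_on S (hcomp a n)"
  using holo2_on_hcomp holo2_on_continuous by blast

lemma hcomp_has_derivative: "(hcomp a n has_derivative hderiv a n p) (at p)"
proof (induction n)
  case 0
  then show ?case by (simp add: has_derivative_ident)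
next
  case (Suc n)
  from diff_chain_at[OF this hmap_has_derivative[of "a n" "hcomp a n p"]]
  show ?case by (simp add: o_def)
qed

lemma hcomp_zero: "hcomp a n 0 = 0"
  by (induction n) (simp_all add: hmap_def zero_prod_def)

text \<open>Starting from \<open>(x, 0)\<close> with \<open>x\<close> nonnegative everything stays
  nonnegative, so dropping the linear term leaves repeated squaring. This gives both that the basin
  is proper and that the potential is not constant.\<close>

lemma hcomp_real_orbit:
  assumes "x \<ge> 0" "\<And>n. a n > 0"
  obtains X Y where "hcomp a n (of_real x, 0) = (of_real X, of_real Y)" "X \<ge> x ^ (2 ^ n)" "Y \<ge> 0"
proof (induction n arbitrary: thesis)
  case 0
  show ?case by (rule 0[of x 0]) (simp_all add: assms)
next
  case (Suc n)
  obtain X Y where XY: "hcomp a n (of_real x, 0) = (of_real X, of_real Y)" "X \<ge> x ^ (2 ^ n)" "Y \<ge> 0"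
    using Suc.IH .
  have "0 \<le> x ^ 2 ^ n" using assms(1) by simp
  then have "X \<ge> 0" "(x ^ 2 ^ n)\<^sup>2 \<le> X\<^sup>2" using XY(2) by (auto intro: power_mono)
  moreover have "x ^ 2 ^ Suc n = (x ^ 2 ^ n)\<^sup>2" by (simp add: power_mult[symmetric] mult.commute)
  ultimately show ?case
    using XY assms(2)[of n] mult_nonneg_nonneg[OF less_imp_le[OF assms(2)[of n]] XY(3)]
    by (intro Suc.prems[of "X\<^sup>2 + a n * Y" "a n * X"]) (auto simp: hmap_def intro!: add_increasing2)
qed

text \<open>The orbit of \<open>(2, 0)\<close> has first coordinate at least
  \<open>2 ^ 2 ^ n\<close> and cannot tend to 0.\<close>

lemma hbasin_neq_UNIV:
  assumes "\<And>n. a n > 0"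
  shows "hbasin a \<noteq> UNIV"
proof
  assume "hbasin a = UNIV"
  then have "(\<lambda>n. hcomp a n (of_real 2, 0)) \<longlonglongrightarrow> 0" by (auto simp: hbasin_def)
  from tendsto_norm[OF tendsto_fst[OF this]]
  have "(\<lambda>n. norm (fst (hcomp a n (of_real 2, 0)))) \<longlonglongrightarrow> 0" by simp
  moreover have "1 \<le> norm (fst (hcomp a n (of_real 2, 0)))" for n
  proof -
    obtain X Y where XY: "hcomp a n (of_real 2, 0) = (of_real X, of_real Y)" "X \<ge> 2 ^ (2 ^ n)"
      by (rule hcomp_real_orbit[of 2 a n]) (use assms in auto)
    have "(1::real) \<le> 2 ^ 2 ^ n" by simp
    then have "1 \<le> X" using XY(2) by linarith
    then show ?thesis using XY(1) by simp
  qed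
  ultimately have "(1::real) \<le> 0"
    by (intro tendsto_lowerbound[where F = sequentially]) auto
  then show False by simp
qed

text \<open>The contraction factor is \<open>norm p + a\<close>, and 1/2 + 1/8 = 5/8.\<close>

lemma norm_hmap_contract:
  assumes "0 \<le> a" "a \<le> 1/8" "norm p < 1/2"
  shows "norm (hmap a p) \<le> 5/8 * norm p"
proof -
  have "norm (hmap a p) \<le> norm p * (norm p + a)"
    using norm_hmap[OF assms(1), of p] by (simp add: algebra_simps power2_eq_square)
  also have "\<dots> \<le> norm p * (5/8)"
    using assms by (intro mult_left_mono) auto
  finally show ?thesis by simp
qed

section \<open>Exhaustion of the basin by copies of the ball\<close>

context
  fixes a :: "nat \<Rightarrow> real"
  assumes a_pos: "\<And>n. a n > 0" and a_le: "\<And>n. a n \<le> 1/8"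
begin

lemmas hcinv_hcomp_pos = hcinv_hcomp[of a, OF a_pos]
lemmas hcomp_hcinv_pos = hcomp_hcinv[of a, OF a_pos]
lemmas holo2_on_hcinv_pos = holo2_on_hcinv[of a, OF a_pos]

text \<open>These are the copies of the ball that exhaust the basin. They increase because every map
  contracts the ball of radius 1/2.\<close>

definition hlevel :: "nat \<Rightarrow> c2 set" where
  "hlevel n = {p. norm (hcomp a n p) < 1/2}"

lemma norm_hcomp_Suc:
  assumes "p \<in> hlevel n"
  shows "norm (hcomp a (Suc n) p) \<le> 5/8 * norm (hcomp a n p)"
  using norm_hmap_contract[of "a n"] a_pos[of n] a_le[of n] assms by (simp add: hlevel_def)

lemma hlevel_mono: "hlevel n \<subseteq> hlevel (Suc n)"
proof
  fix p assume p: "p \<in> hlevel n"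
  then show "p \<in> hlevel (Suc n)"
    using norm_hcomp_Suc[OF p] norm_ge_zero[of "hcomp a n p"] unfolding hlevel_def mem_Collect_eq
    by linarith
qed

lemma hbasin_eq_Union: "hbasin a = (\<Union>n. hlevel n)"
proof (intro equalityI subsetI)
  fix p assume "p \<in> hbasin a"
  then have "(\<lambda>n. norm (hcomp a n p)) \<longlonglongrightarrow> 0"
    by (simp add: hbasin_def tendsto_norm_zero)
  then have "\<forall>\<^sub>F n in sequentially. norm (hcomp a n p) < 1/2"
    by (rule order_tendstoD) simp
  then show "p \<in> (\<Union>n. hlevel n)"
    by (auto simp: hlevel_def eventually_sequentially)
next
  fix p assume "p \<in> (\<Union>n. hlevel n)"
  then obtain N where N: "p \<in> hlevel N" by blast
  have lev: "p \<in> hlevel n" if "n \<ge> N" for n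
    using that N hlevel_mono by (induction rule: dec_induct) auto
  \<comment> \<open>From \<open>N\<close> on the orbit shrinks by the factor 5/8, so it is dominated
    by a geometric series and tends to 0.\<close>
  have "summable (\<lambda>n. hcomp a n p)"
    by (rule summable_ratio_test[of "5/8" N]) (use norm_hcomp_Suc lev in auto)
  then show "p \<in> hbasin a" unfolding hbasin_def using summable_LIMSEQ_zero by blast
qed

lemma hcinv_ball: "hcinv a n ` ball 0 (1/2) = hlevel n"
proof (intro equalityI subsetI)
  fix p assume "p \<in> hlevel n"
  then show "p \<in> hcinv a n ` ball 0 (1/2)"
    using hcinv_hcomp_pos[of n p] by (intro image_eqI[of _ _ "hcomp a n p"]) (simp_all add: hlevel_def)
qed (use hcomp_hcinv_pos in \<open>force simp: hlevel_def\<close>)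

lemma domain2_hlevel: "domain2 (hlevel n)"
proof -
  have "open (hlevel n)"
    unfolding hlevel_def by (intro open_Collect_less continuous_intros continuous_on_hcomp)
  moreover have "connected (hlevel n)"
    unfolding hcinv_ball[symmetric]
    by (intro connected_continuous_image holo2_on_continuous[OF holo2_on_hcinv_pos]) simp
  moreover have "0 \<in> hlevel n" by (simp add: hlevel_def hcomp_zero)
  ultimately show ?thesis unfolding domain2_def by blast
qed

lemma biholomorphic2_hlevel: "biholomorphic2 (hlevel n) (ball 0 1)"
proof (rule biholomorphic2I)
  let ?f = "\<lambda>p. 2 *\<^sub>R hcomp a n p" and ?g = "\<lambda>q. hcinv a n ((1/2) *\<^sub>R q)"
  show "open (hlevel n)" using domain2_hlevel by (simp add: domain2_def)
  show "holo2_on ?f (hlevel n)"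
    by (rule holo2_on_compose[OF holo2_on_hcomp holo2_on_scaleR[of 2 UNIV]]) simp
  show "holo2_on ?g (ball 0 1)"
    by (rule holo2_on_compose[OF holo2_on_scaleR holo2_on_hcinv_pos[of _ UNIV]]) simp
  show "?g (?f x) = x" for x using hcinv_hcomp_pos by simp
  show "?f (?g y) = y" for y using hcomp_hcinv_pos by simp
  show "?f x \<in> ball 0 1" if "x \<in> hlevel n" for x
    using that unfolding hlevel_def by simp
  show "?g y \<in> hlevel n" if "y \<in> ball 0 1" for y
    using that unfolding hlevel_def by (simp add: hcomp_hcinv_pos del: scaleR_Pair)
qed simp

lemma domain2_hbasin: "domain2 (hbasin a)"
proof -
  have "0 \<in> hlevel n" for n by (simp add: hlevel_def hcomp_zero)
  then have "connected (\<Union>n. hlevel n)"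
    using domain2_hlevel by (intro connected_Union) (auto simp: domain2_def)
  moreover have "open (\<Union>n. hlevel n)" using domain2_hlevel by (auto simp: domain2_def)
  ultimately show ?thesis
    using domain2_hlevel[of 0] unfolding hbasin_eq_Union domain2_def by blast
qed

text \<open>Linear discs in the image of the iterates pull back to discs in the basin.  The derivatives of
  the iterates tend to zero along an orbit in the basin, so these discs become arbitrarily large.\<close>

lemma hderiv_tendsto_zero:
  assumes "p \<in> hbasin a"
  shows "(\<lambda>n. hderiv a n p v) \<longlonglongrightarrow> 0"
proof -
  have "(\<lambda>n. norm (hcomp a n p)) \<longlonglongrightarrow> 0"
    using assms by (simp add: hbasin_def tendsto_norm_zero)
  then have "\<forall>\<^sub>F n in sequentially. norm (hcomp a n p) < 1/8"
    by (rule order_tendstoD) simp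
  then obtain N where N: "\<And>n. n \<ge> N \<Longrightarrow> norm (hcomp a n p) < 1/8"
    by (auto simp: eventually_sequentially)
  have "norm (hderiv a (Suc n) p v) \<le> 1/2 * norm (hderiv a n p v)" if "n \<ge> N" for n
  proof -
    define q where "q = hderiv a n p v"
    have eq: "hderiv a (Suc n) p v = (2 * fst (hcomp a n p) * fst q, 0) + cscale2 (of_real (a n)) (snd q, fst q)"
      by (simp add: q_def cscale2_def)
    have "norm (hderiv a (Suc n) p v) \<le> norm (2 * fst (hcomp a n p) * fst q, 0::complex)
        + norm (cscale2 (of_real (a n)) (snd q, fst q))"
      unfolding eq by (rule norm_triangle_ineq)
    also have "\<dots> = 2 * cmod (fst (hcomp a n p)) * cmod (fst q) + a n * norm q"
      using a_pos[of n] by (simp add: norm_cscale2 norm_swap norm_Pair_zero norm_mult)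
    \<comment> \<open>The derivative of the square contributes 2/8 and the linear part 1/8, together
      less than 1/2.\<close>
    also have "\<dots> \<le> 2 * (1/8) * norm q + 1/8 * norm q"
    proof (intro add_mono mult_mono)
      show "cmod (fst (hcomp a n p)) \<le> 1/8"
        using N[OF that] norm_fst_le[of "fst (hcomp a n p)" "snd (hcomp a n p)"] by simp
      show "cmod (fst q) \<le> norm q" using norm_fst_le[of "fst q" "snd q"] by simp
    qed (use a_le[of n] in auto)
    also have "\<dots> \<le> 1/2 * norm q" by simp
    finally show ?thesis by (simp add: q_def)
  qed
  then have "summable (\<lambda>n. hderiv a n p v)"
    by (intro summable_ratio_test[of "1/2" N]) auto
  then show ?thesis by (rule summable_LIMSEQ_zero)
qed

lemma large_disc:
  assumes p: "p \<in> hbasin a" and R: "R > 0"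
  obtains \<phi> where "holo_disc \<phi>" "\<phi> ` ball 0 1 \<subseteq> hbasin a" "\<phi> 0 = p"
    "(deriv (fst \<circ> \<phi>) 0, deriv (snd \<circ> \<phi>) 0) = cscale2 (complex_of_real R) v"
proof -
  have "(\<lambda>n. norm (hcomp a n p) + R * norm (hderiv a n p v)) \<longlonglongrightarrow> norm (0::c2) + R * norm (0::c2)"
    using p by (intro tendsto_intros hderiv_tendsto_zero) (auto simp: hbasin_def)
  then have "\<forall>\<^sub>F n in sequentially. norm (hcomp a n p) + R * norm (hderiv a n p v) < 1/2"
    by (rule order_tendstoD) simp
  \<comment> \<open>At this stage the linear disc through \<open>hcomp a n p\<close> with derivative
    \<open>R\<close> times \<open>hderiv a n p v\<close> fits into the ball of radius 1/2.\<close>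
  then obtain n where n: "norm (hcomp a n p) + R * norm (hderiv a n p v) < 1/2"
    by (auto simp: eventually_sequentially)
  define q where "q = hcomp a n p"
  define w where "w = cscale2 (of_real R) (hderiv a n p v)"
  define \<phi> where "\<phi> z = hcinv a n (q + cscale2 z w)" for z
  have w: "norm q + norm w < 1/2" using n R by (simp add: q_def w_def norm_cscale2)
  have ball: "q + cscale2 z w \<in> ball 0 (1/2)" if "z \<in> ball 0 1" for z
  proof -
    have "norm (q + cscale2 z w) \<le> norm q + cmod z * norm w"
      using norm_triangle_ineq[of q "cscale2 z w"] by (simp add: norm_cscale2)
    also have "cmod z * norm w \<le> 1 * norm w" using that by (intro mult_right_mono) auto
    finally show ?thesis using w by simp
  qed
  have "holo_disc \<phi>"
    using holomorphic_on_along_line[OF holo2_on_hcinv_pos[where U=UNIV], of "ball 0 1" q w]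
    by (simp add: holo_disc_def o_def \<phi>_def)
  moreover have "\<phi> ` ball 0 1 \<subseteq> hbasin a"
    using ball hcinv_ball[of n] unfolding hbasin_eq_Union \<phi>_def by blast
  moreover have "\<phi> 0 = p"
    by (simp add: \<phi>_def q_def cscale2_def zero_prod_def[symmetric] hcinv_hcomp_pos)
  moreover have "(deriv (fst \<circ> \<phi>) 0, deriv (snd \<circ> \<phi>) 0) = cscale2 (complex_of_real R) v"
  proof -
    obtain L where L: "clinear2 L" "(hcinv a n has_derivative L) (at q)"
      using holo2_on_hcinv_pos[where U=UNIV] unfolding holo2_on_def by blast
    \<comment> \<open>Differentiating \<open>hcinv a n (hcomp a n x) = x\<close> shows that
      \<open>L\<close> undoes \<open>hderiv a n p\<close>; hence the pulled-back disc has derivative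
      \<open>R\<close> times \<open>v\<close>.\<close>
    have "((\<lambda>x. hcinv a n (hcomp a n x)) has_derivative (\<lambda>h. L (hderiv a n p h))) (at p)"
      using diff_chain_at[OF hcomp_has_derivative L(2)[unfolded q_def]] by (simp add: o_def)
    then have "((\<lambda>x. x) has_derivative (\<lambda>h. L (hderiv a n p h))) (at p)"
      by (simp add: hcinv_hcomp_pos)
    then have "(\<lambda>h. L (hderiv a n p h)) = (\<lambda>h. h)"
      by (rule has_derivative_unique[OF _ has_derivative_ident])
    then have Lw: "L w = cscale2 (of_real R) v"
      unfolding w_def clinear2_scale[OF L(1)] by metis
    have L0: "(hcinv a n has_derivative L) (at (q + cscale2 0 w))"
      using L(2) by (simp add: cscale2_def zero_prod_def[symmetric])
    show ?thesis
      using has_field_derivative_along_line[OF L0 L(1), THEN DERIV_imp_deriv]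
      by (simp add: o_def \<phi>_def Lw)
  qed
  ultimately show thesis using that by blast
qed

text \<open>Discs with derivative \<open>r\<close> times \<open>v\<close> exist for every positive
  \<open>r\<close>, so \<open>1 / r\<close> becomes arbitrarily small. Nonnegativity bounds the set
  below, and \<open>r = 1\<close> shows that it is nonempty.\<close>

lemma kobayashi_royden_hbasin:
  assumes "p \<in> hbasin a"
  shows "kobayashi_royden (hbasin a) p v = 0"
proof -
  define S where "S = {1 / r | r. r > 0 \<and>
      (\<exists>\<phi>. holo_disc \<phi> \<and> \<phi> ` ball 0 1 \<subseteq> hbasin a \<and> \<phi> 0 = p \<and>
            (deriv (fst \<circ> \<phi>) 0, deriv (snd \<circ> \<phi>) 0) = cscale2 (complex_of_real r) v)}"
  have S: "1 / r \<in> S" if "r > 0" for r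
    using large_disc[OF assms that, of v] that unfolding S_def mem_Collect_eq by metis
  have nonneg: "x \<ge> 0" if "x \<in> S" for x using that by (auto simp: S_def)
  then have "bdd_below S" by (meson bdd_belowI)
  have "Inf S \<le> e" if "e > 0" for e :: real
    using cInf_lower[OF S[of "1/e"] \<open>bdd_below S\<close>] that by simp
  then have "Inf S \<le> 0" using field_le_epsilon[of "Inf S" 0] by simp
  moreover have "Inf S \<ge> 0"
    using S[of 1] nonneg by (intro cInf_greatest) auto
  ultimately show ?thesis by (simp add: kobayashi_royden_def S_def)
qed

end

subsection \<open>The bounded plurisubharmonic function\<close>

context
  fixes a :: "nat \<Rightarrow> real"
  assumes a_eq: "\<And>n. a n = exp (- (2 ^ (n + 2)))"
begin

lemma double_exp_pos: "a n > 0"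
  by (simp add: a_eq)

text \<open>Because of the offset 2 in \<open>a_eq\<close> the exponent is at least 4, and
  \<open>exp 3 >= 2 ^ 3\<close> follows from \<open>exp 1 >= 2\<close>.\<close>

lemma double_exp_le: "a n \<le> 1/8"
proof -
  have "(4::real) \<le> 2 ^ (n + 2)" by simp
  then have "a n \<le> exp (- (1 + 1 + 1))" unfolding a_eq exp_le_cancel_iff by linarith
  also have "\<dots> = inverse (exp 1 * exp 1 * exp 1)" by (simp only: exp_minus exp_add)
  also have "\<dots> \<le> inverse (2 * 2 * 2)"
    using exp_ge_add_one_self[of 1] by (intro le_imp_inverse_le mult_mono) auto
  finally show ?thesis by simp
qed

text \<open>This is critical growth: the coefficients are squared in each step, exactly as the
  quadratic term squares the first coordinate.\<close>

lemma double_exp_Suc: "a (Suc n) = (a n)\<^sup>2"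
  by (simp add: a_eq exp_double[symmetric])

text \<open>The entry \<open>a n\<close> keeps the maximum positive, so its logarithm is finite and
  continuous, and it yields the lower bound for the potentials.\<close>

definition hmax :: "nat \<Rightarrow> c2 \<Rightarrow> real" where
  "hmax n p = max (max (cmod (fst (hcomp a n p))) (cmod (snd (hcomp a n p)))) (a n)"

text \<open>The factor 2 absorbs the constant in \<open>hmax_Suc\<close>: in one step
  \<open>2 * hmax\<close> becomes at most its own square, so division by \<open>2 ^ n\<close> gives
  a decreasing sequence.\<close>

definition hpot :: "nat \<Rightarrow> c2 \<Rightarrow> real" where
  "hpot n p = ln (2 * hmax n p) / 2 ^ n"

lemma hmax_ge: "a n \<le> hmax n p"
  by (simp add: hmax_def)

lemma hmax_pos: "hmax n p > 0"
  using hmax_ge double_exp_pos less_le_trans by blast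

text \<open>Every entry of the new maximum is bounded by a sum of at most two products of old
  entries; for the coefficient itself the product is \<open>(a n)^2\<close>.\<close>

lemma hmax_Suc: "hmax (Suc n) p \<le> 2 * (hmax n p)\<^sup>2"
proof -
  define z w m where "z = fst (hcomp a n p)" and "w = snd (hcomp a n p)" and "m = hmax n p"
  have m: "cmod z \<le> m" "cmod w \<le> m" "a n \<le> m" "0 < a n"
    by (auto simp: z_def w_def m_def hmax_def double_exp_pos)
  have aw: "a n * cmod w \<le> m\<^sup>2" "a n * cmod z \<le> m\<^sup>2" "(cmod z)\<^sup>2 \<le> m\<^sup>2" "(a n)\<^sup>2 \<le> m\<^sup>2"
    using m by (auto simp: power2_eq_square intro: mult_mono)
  have "cmod (z\<^sup>2 + of_real (a n) * w) \<le> (cmod z)\<^sup>2 + a n * cmod w"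
    using norm_triangle_ineq[of "z\<^sup>2" "of_real (a n) * w"] m(4) by (simp add: norm_mult norm_power)
  then have "cmod (z\<^sup>2 + of_real (a n) * w) \<le> 2 * m\<^sup>2" using aw by linarith
  moreover have "a n * cmod z \<le> 2 * m\<^sup>2" using aw(2) zero_le_power2[of m] by linarith
  then have "cmod (of_real (a n) * z) \<le> 2 * m\<^sup>2" using m(4) by (simp add: norm_mult)
  moreover have "(a n)\<^sup>2 \<le> 2 * m\<^sup>2" using aw(4) zero_le_power2[of m] by linarith
  ultimately show ?thesis
    using aw by (simp add: hmax_def[of "Suc n"] hmap_def z_def[symmetric] w_def[symmetric]
        m_def[symmetric] double_exp_Suc)
qed

lemma hpot_decseq: "hpot (Suc n) p \<le> hpot n p"
proof -
  have "ln (2 * hmax (Suc n) p) \<le> ln ((2 * hmax n p)\<^sup>2)"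
    using hmax_Suc[of n p] hmax_pos[of n p] hmax_pos[of "Suc n" p] by (subst ln_le_cancel_iff) (simp_all add: power_mult_distrib)
  also have "\<dots> = 2 * ln (2 * hmax n p)" by (subst ln_realpow) (simp_all add: hmax_pos)
  finally show ?thesis by (simp add: hpot_def field_simps)
qed

text \<open>The coefficient alone contributes \<open>ln (a n) / 2 ^ n = -4\<close>.\<close>

lemma hpot_ge: "hpot n p \<ge> -4"
proof -
  have "ln (a n) \<le> ln (2 * hmax n p)"
    using hmax_ge[of n p] double_exp_pos[of n] by (subst ln_le_cancel_iff) auto
  then have "- (2 ^ (n + 2)) \<le> ln (2 * hmax n p)" by (simp add: a_eq)
  then show ?thesis by (simp add: hpot_def field_simps)
qed

lemma continuous_on_hmax: "continuous_on S (hmax n)"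
  unfolding hmax_def by (intro continuous_intros continuous_on_hcomp)

lemma continuous_on_hpot: "continuous_on S (hpot n)"
  unfolding hpot_def using hmax_pos
  by (intro continuous_intros continuous_on_hmax) (auto simp: less_imp_neq[symmetric])

text \<open>On a complex line \<open>2 * hmax n\<close> is the maximum of the moduli of three
  holomorphic functions, one of them constant. The mean inequality holds for each of them with the
  common majorant \<open>h\<close>, hence for the maximum.\<close>

lemma hpot_mean:
  "hpot n p \<le> integral {0..2*pi} (\<lambda>\<theta>. hpot n (p + cscale2 (cis \<theta>) b)) / (2*pi)"
proof -
  define h where "h z = ln (2 * hmax n (p + cscale2 z b))" for z
  define I where "I = integral {0..2*pi} (\<lambda>\<theta>. h (cis \<theta>))"
  have exph: "exp (h z) = 2 * hmax n (p + cscale2 z b)" for z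
    using hmax_pos by (simp add: h_def)
  have conth: "continuous_on UNIV h"
    unfolding h_def using hmax_pos
    by (intro continuous_intros continuous_on_compose2[OF continuous_on_hmax[of UNIV]])
      (auto simp: less_imp_neq[symmetric])
  note hol = holomorphic_on_along_line[OF holo2_on_hcomp[of a n UNIV], of UNIV p b, simplified]
  have "cmod (2 * fst (hcomp a n (p + cscale2 0 b))) \<le> exp (I / (2 * pi))"
    unfolding I_def
    by (rule holomorphic_log_majorant_mean[OF _ conth])
      (use hol in \<open>auto simp: exph norm_mult hmax_def intro!: holomorphic_intros\<close>)
  moreover have "cmod (2 * snd (hcomp a n (p + cscale2 0 b))) \<le> exp (I / (2 * pi))"
    unfolding I_def
    by (rule holomorphic_log_majorant_mean[OF _ conth])
      (use hol in \<open>auto simp: exph norm_mult hmax_def intro!: holomorphic_intros\<close>)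
  moreover have "cmod (of_real (2 * a n)) \<le> exp (I / (2 * pi))"
    unfolding I_def
    by (rule holomorphic_log_majorant_mean[OF _ conth, of "\<lambda>_. of_real (2 * a n)"])
      (use double_exp_pos[of n] hmax_ge[of n] in \<open>auto simp: exph norm_mult\<close>)
  ultimately have "2 * hmax n p \<le> exp (I / (2 * pi))"
    using double_exp_pos[of n]
    by (simp add: hmax_def norm_mult cscale2_def zero_prod_def[symmetric])
  then have "ln (2 * hmax n p) \<le> ln (exp (I / (2 * pi)))"
    using hmax_pos[of n p] by (subst ln_le_cancel_iff) simp_all
  then have "ln (2 * hmax n p) \<le> I / (2 * pi)" by simp
  then have "hpot n p \<le> I / (2 * pi) / 2 ^ n"
    unfolding hpot_def by (intro divide_right_mono) auto
  also have "\<dots> = integral {0..2*pi} (\<lambda>\<theta>. hpot n (p + cscale2 (cis \<theta>) b)) / (2*pi)"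
    by (simp add: I_def hpot_def h_def)
  finally show ?thesis .
qed

section \<open>The limit potential and its plurisubharmonicity\<close>

definition hlim :: "c2 \<Rightarrow> real" where
  "hlim p = lim (\<lambda>n. hpot n p)"

lemma hpot_tendsto: "(\<lambda>n. hpot n p) \<longlonglongrightarrow> hlim p"
  and hlim_le: "hlim p \<le> hpot n p"
proof -
  have "decseq (\<lambda>n. hpot n p)" using hpot_decseq by (simp add: decseq_Suc_iff)
  then obtain L where L: "(\<lambda>n. hpot n p) \<longlonglongrightarrow> L" "\<forall>i. L \<le> hpot i p"
    using decseq_convergent[of "\<lambda>n. hpot n p" "-4"] hpot_ge by blast
  moreover have "hlim p = L" using L(1) by (simp add: hlim_def limI)
  ultimately show "(\<lambda>n. hpot n p) \<longlonglongrightarrow> hlim p" "hlim p \<le> hpot n p" by auto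
qed

text \<open>A decreasing limit of continuous functions is upper semicontinuous: near
  \<open>x\<close> a single \<open>hpot n\<close> stays below \<open>s\<close>, and it dominates
  \<open>hlim\<close>.\<close>

lemma usc_on_hlim: "usc_on U (\<lambda>p. ereal (hlim p))"
  unfolding usc_on_def
proof (intro ballI allI impI)
  fix x s assume s: "ereal (hlim x) < s"
  have "(\<lambda>n. ereal (hpot n x)) \<longlonglongrightarrow> ereal (hlim x)" using hpot_tendsto by simp
  then have "\<forall>\<^sub>F n in sequentially. ereal (hpot n x) < s" using s by (rule order_tendstoD)
  then obtain n where n: "ereal (hpot n x) < s" by (auto simp: eventually_sequentially)
  have "(hpot n \<longlongrightarrow> hpot n x) (at x within U)"
    using continuous_on_hpot[of UNIV n] by (meson UNIV_I continuous_on_def subset_UNIV tendsto_within_subset)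
  then have "((\<lambda>y. ereal (hpot n y)) \<longlongrightarrow> ereal (hpot n x)) (at x within U)" by simp
  then have "\<forall>\<^sub>F y in at x within U. ereal (hpot n y) < s" using n by (rule order_tendstoD)
  then show "\<forall>\<^sub>F y in at x within U. ereal (hlim y) < s"
    by eventually_elim (meson hlim_le ereal_less_eq(3) le_less_trans)
qed

text \<open>Dominated convergence carries the mean inequality over to the limit; monotonicity and
  the lower bound -4 give the dominating function
  \<open>\<bar>v 0 \<theta>\<bar> + 4\<close>.\<close>

lemma hlim_mean: "ereal (hlim p) \<le> circle_mean (\<lambda>p. ereal (hlim p)) p b"
proof -
  define v where "v n \<theta> = hpot n (p + cscale2 (cis \<theta>) b)" for n \<theta>
  define u where "u \<theta> = hlim (p + cscale2 (cis \<theta>) b)" for \<theta>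
  have v: "continuous_on S (v n)" for S n
    unfolding v_def by (intro continuous_on_compose2[OF continuous_on_hpot[of UNIV]] continuous_intros) auto
  have vint: "set_integrable lborel {0..2*pi} (v n)" for n
    using borel_integrable_compact[OF _ v, of "{0..2*pi}"] by (simp add: set_integrable_def mult.commute)
  have vm: "v n \<in> borel_measurable borel" for n
    using v borel_measurable_continuous_onI by blast
  have vu: "(\<lambda>n. v n \<theta>) \<longlonglongrightarrow> u \<theta>" for \<theta> unfolding v_def u_def by (rule hpot_tendsto)
  have um: "u \<in> borel_measurable borel" by (rule borel_measurable_LIMSEQ_real[OF vu vm])
  have bound: "norm (v n \<theta>) \<le> \<bar>v 0 \<theta>\<bar> + 4" for n \<theta>
  proof -
    have "v n \<theta> \<le> v 0 \<theta>" unfolding v_def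
      by (induction n) (use hpot_decseq order_trans in \<open>blast+\<close>)
    moreover have "-4 \<le> v n \<theta>" unfolding v_def by (rule hpot_ge)
    ultimately show ?thesis by auto
  qed
  let ?J = "indicator {0..2*pi} :: real \<Rightarrow> real"
  have w: "integrable lborel (\<lambda>\<theta>. ?J \<theta> *\<^sub>R (\<bar>v 0 \<theta>\<bar> + 4))"
    using borel_integrable_compact[of "{0..2*pi}" "\<lambda>\<theta>. \<bar>v 0 \<theta>\<bar> + 4"]
    by (simp add: mult.commute continuous_intros v)
  have lim: "(\<lambda>n. ?J \<theta> *\<^sub>R v n \<theta>) \<longlonglongrightarrow> ?J \<theta> *\<^sub>R u \<theta>" for \<theta>
    by (intro tendsto_intros vu)
  have bd: "norm (?J \<theta> *\<^sub>R v n \<theta>) \<le> ?J \<theta> *\<^sub>R (\<bar>v 0 \<theta>\<bar> + 4)" for n \<theta>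
    using bound[of n \<theta>] by (auto split: split_indicator)
  have um': "(\<lambda>\<theta>. ?J \<theta> *\<^sub>R u \<theta>) \<in> borel_measurable lborel"
    and vm': "(\<lambda>\<theta>. ?J \<theta> *\<^sub>R v n \<theta>) \<in> borel_measurable lborel" for n
    using um vm by auto
  have ui: "set_integrable lborel {0..2*pi} u"
    unfolding set_integrable_def
    by (rule integrable_dominated_convergence[where s = "\<lambda>n \<theta>. ?J \<theta> *\<^sub>R v n \<theta>", OF um' vm' w]) (use lim bd in auto)
  have "(\<lambda>n. LINT \<theta>:{0..2*pi}|lborel. v n \<theta>) \<longlonglongrightarrow> (LINT \<theta>:{0..2*pi}|lborel. u \<theta>)"
    unfolding set_lebesgue_integral_def
    by (rule integral_dominated_convergence[where s = "\<lambda>n \<theta>. ?J \<theta> *\<^sub>R v n \<theta>", OF um' vm' w]) (use lim bd in auto)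
  then have "(\<lambda>n. (LINT \<theta>:{0..2*pi}|lborel. v n \<theta>) / (2*pi)) \<longlonglongrightarrow> (LINT \<theta>:{0..2*pi}|lborel. u \<theta>) / (2*pi)"
    by (intro tendsto_intros) auto
  moreover have "hlim p \<le> (LINT \<theta>:{0..2*pi}|lborel. v n \<theta>) / (2*pi)" for n
    using hlim_le[of p n] hpot_mean[of n p b] set_borel_integral_eq_integral(2)[OF vint[of n]]
    by (simp add: v_def[abs_def])
  ultimately have "hlim p \<le> (LINT \<theta>:{0..2*pi}|lborel. u \<theta>) / (2*pi)"
    by (intro tendsto_lowerbound[where F = sequentially]) auto
  then show ?thesis
    using circle_mean_real[of hlim p b] ui by (simp add: u_def[abs_def])
qed

lemma psh_on_hlim: "psh_on U (\<lambda>p. ereal (hlim p))"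
  unfolding psh_on_def using usc_on_hlim hlim_mean by simp

text \<open>Once the orbit is in the ball of radius 1/2, \<open>2 * hmax n p\<close> is at most 1,
  and the potentials only decrease afterwards.\<close>

lemma hlim_nonpos:
  assumes "p \<in> hbasin a"
  shows "hlim p \<le> 0"
proof -
  obtain n where n: "norm (hcomp a n p) < 1/2"
    using assms unfolding hbasin_eq_Union[of a, OF double_exp_pos double_exp_le]
      hlevel_def[of a, OF double_exp_pos double_exp_le] by blast
  then have "2 * hmax n p \<le> 1"
    using norm_fst_le[of "fst (hcomp a n p)" "snd (hcomp a n p)"]
      norm_snd_le[of "snd (hcomp a n p)" "fst (hcomp a n p)"] double_exp_le[of n]
    by (simp add: hmax_def)
  then have "ln (2 * hmax n p) \<le> 0" using hmax_pos[of n p] by simp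
  then have "hpot n p \<le> 0" by (simp add: hpot_def divide_nonpos_pos)
  then show ?thesis using hlim_le[of p n] by simp
qed

lemma hlim_zero: "hlim 0 \<le> -3"
proof -
  have "hmax 0 0 = a 0" using double_exp_pos[of 0] by (simp add: hmax_def)
  then have "hpot 0 0 = ln 2 - 4" by (simp add: hpot_def a_eq ln_mult)
  then show ?thesis using hlim_le[of 0 0] ln_2_less_1 by simp
qed

lemma hlim_real:
  assumes "x > 0"
  shows "hlim (of_real x, 0) \<ge> ln x"
proof (rule tendsto_lowerbound[OF hpot_tendsto])
  have "hpot n (of_real x, 0) \<ge> ln x" for n
  proof -
    obtain X Y where XY: "hcomp a n (of_real x, 0) = (of_real X, of_real Y)" "X \<ge> x ^ (2 ^ n)" "Y \<ge> 0"
      using hcomp_real_orbit[of x a n] assms double_exp_pos by (metis less_imp_le)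
    have "0 < x ^ 2 ^ n" using assms by simp
    moreover have "X \<le> hmax n (of_real x, 0)" by (auto simp: hmax_def XY(1))
    ultimately have "x ^ 2 ^ n \<le> 2 * hmax n (of_real x, 0)" using XY(2) hmax_pos[of n "(of_real x, 0)"] by linarith
    then have "ln (x ^ 2 ^ n) \<le> ln (2 * hmax n (of_real x, 0))"
      using \<open>0 < x ^ 2 ^ n\<close> by (simp add: hmax_pos)
    then show ?thesis using assms by (simp add: hpot_def ln_realpow field_simps)
  qed
  then show "\<forall>\<^sub>F n in sequentially. hpot n (of_real x, 0) \<ge> ln x" by simp
qed simp

lemma short_C2_hbasin: "short_C2 (hbasin a)"
proof -
  note facts = double_exp_pos double_exp_le
  have x: "(of_real (1/4), 0) \<in> hbasin a"
  proof -
    have "(of_real (1/4), 0) \<in> {p. norm (hcomp a 0 p) < 1/2}"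
      by (simp add: norm_Pair_zero)
    then show ?thesis
      unfolding hbasin_eq_Union[of a, OF facts] hlevel_def[of a, OF facts] by blast
  qed
  \<comment> \<open>Since \<open>ln 2 < 1\<close>, the value at \<open>(1/4, 0)\<close> exceeds -2,
    while the value at the origin is at most -3.\<close>
  have "ln (1/4) = - 2 * ln (2::real)"
    using ln_realpow[of "2::real" 2] by (simp add: ln_div)
  then have ne: "hlim 0 \<noteq> hlim (of_real (1/4), 0)"
    using hlim_zero hlim_real[of "1/4"] ln_2_less_1 by simp
  have 0: "0 \<in> hbasin a" by (simp add: hbasin_def hcomp_zero)
  have "\<exists>u. psh_on (hbasin a) u \<and> (\<exists>M::real. \<forall>x\<in>hbasin a. u x \<le> M)
      \<and> (\<exists>x\<in>hbasin a. \<exists>y\<in>hbasin a. u x \<noteq> u y)"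
  proof (intro exI conjI)
    show "psh_on (hbasin a) (\<lambda>p. ereal (hlim p))" by (rule psh_on_hlim)
    show "\<forall>x\<in>hbasin a. ereal (hlim x) \<le> ereal 0" using hlim_nonpos by simp
    show "\<exists>x\<in>hbasin a. \<exists>y\<in>hbasin a. ereal (hlim x) \<noteq> ereal (hlim y)"
      using 0 x ne by blast
  qed
  moreover have "\<exists>B :: nat \<Rightarrow> c2 set.
      (\<forall>j. domain2 (B j) \<and> biholomorphic2 (B j) (ball 0 1) \<and> B j \<subseteq> B (Suc j)) \<and> (\<Union>j. B j) = hbasin a"
    using domain2_hlevel[of a, OF facts] biholomorphic2_hlevel[of a, OF facts]
      hlevel_mono[of a, OF facts] hbasin_eq_Union[of a, OF facts] by metis
  ultimately show ?thesis
    unfolding short_C2_def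
    using domain2_hbasin[of a, OF facts] kobayashi_royden_hbasin[of a, OF facts] by blast
qed

end

subsection \<open>The Fatou--Bieberbach case\<close>

text \<open>Needed to pass to the limit in identities such as
  \<open>shears b n (shears_inv b n q) = q\<close>, where both the map and its argument vary with
  \<open>n\<close>.\<close>

lemma uniform_limit_diagonal:
  fixes f :: "nat \<Rightarrow> 'a::metric_space \<Rightarrow> 'b::metric_space"
  assumes lim: "uniform_limit S f g sequentially" and "open S" "x \<in> S"
    and cont: "\<And>n. continuous_on S (f n)" and X: "X \<longlonglongrightarrow> x"
  shows "(\<lambda>n. f n (X n)) \<longlonglongrightarrow> g x"
proof -
  have "continuous_on S g"
    by (rule uniform_limit_theorem[OF _ lim]) (simp_all add: cont)
  then have "isCont g x" using assms(2,3) continuous_on_eq_continuous_at by blast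
  then have 1: "(\<lambda>n. g (X n)) \<longlonglongrightarrow> g x" using X by (rule isCont_tendsto_compose)
  have XS: "\<forall>\<^sub>F n in sequentially. X n \<in> S" using X assms(2,3) by (rule topological_tendstoD)
  show ?thesis
  proof (rule tendstoI)
    fix e :: real assume e: "e > 0"
    have "\<forall>\<^sub>F n in sequentially. dist (g (X n)) (g x) < e / 2"
      using 1 e by (intro tendstoD) auto
    moreover have "\<forall>\<^sub>F n in sequentially. \<forall>y\<in>S. dist (f n y) (g y) < e / 2"
      using lim e by (intro uniform_limitD) auto
    ultimately show "\<forall>\<^sub>F n in sequentially. dist (f n (X n)) (g x) < e"
      using XS
    proof eventually_elim
      case (elim n)
      then have "dist (f n (X n)) (g (X n)) < e / 2" by blast
      with elim(1) show ?case using dist_triangle[of "f n (X n)" "g x" "g (X n)"] by linarith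
    qed
  qed
qed

section \<open>Shears and their compositions\<close>

definition shear :: "nat \<Rightarrow> real \<Rightarrow> c2 \<Rightarrow> c2" where
  "shear n b p = (if even n then (fst p, snd p + of_real b * (fst p)\<^sup>2)
     else (fst p + of_real b * (snd p)\<^sup>2, snd p))"

lemma shear_inverse: "shear n (- b) (shear n b p) = p" "shear n b (shear n (- b) p) = p"
  by (simp_all add: shear_def)

lemma norm_fst_c2: "cmod (fst p) \<le> norm (p :: c2)"
  using norm_fst_le[of "fst p" "snd p"] by simp

lemma norm_snd_c2: "cmod (snd p) \<le> norm (p :: c2)"
  using norm_snd_le[of "snd p" "fst p"] by simp

lemma norm_zero_Pair: "norm (0, x) = norm x"
  by (simp add: norm_Pair)

lemma norm_shear_diff: "norm (shear n b p - p) \<le> \<bar>b\<bar> * (norm p)\<^sup>2"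
proof -
  have "shear n b p - p = (if even n then (0, of_real b * (fst p)\<^sup>2) else (of_real b * (snd p)\<^sup>2, 0))"
    by (cases p) (simp add: shear_def)
  then have "norm (shear n b p - p) = \<bar>b\<bar> * (if even n then cmod (fst p) else cmod (snd p))\<^sup>2"
    by (simp add: norm_zero_Pair norm_Pair_zero norm_mult norm_power)
  also have "\<dots> \<le> \<bar>b\<bar> * (norm p)\<^sup>2"
    using norm_fst_c2[of p] norm_snd_c2[of p] by (intro mult_left_mono power_mono) auto
  finally show ?thesis .
qed

lemma norm_shear: "norm (shear n b p) \<le> norm p + \<bar>b\<bar> * (norm p)\<^sup>2"
  using norm_shear_diff[of n b p] norm_triangle_ineq[of p "shear n b p - p"] by simp

lemma norm_square_diff:
  fixes x y :: complex
  assumes "cmod x \<le> R" "cmod y \<le> R"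
  shows "cmod (x\<^sup>2 - y\<^sup>2) \<le> 2 * R * cmod (x - y)"
proof -
  have "x\<^sup>2 - y\<^sup>2 = (x + y) * (x - y)" by (simp add: power2_eq_square algebra_simps)
  then have "cmod (x\<^sup>2 - y\<^sup>2) = cmod (x + y) * cmod (x - y)" by (simp add: norm_mult)
  also have "\<dots> \<le> 2 * R * cmod (x - y)"
    using norm_triangle_ineq[of x y] assms by (intro mult_right_mono) auto
  finally show ?thesis .
qed

text \<open>The only nonlinear part is the square of one coordinate, which has Lipschitz constant
  \<open>2 * R\<close> on the disc of radius \<open>R\<close>.\<close>

lemma shear_lipschitz:
  assumes "norm p \<le> R" "norm q \<le> R"
  shows "norm (shear n b p - shear n b q) \<le> (1 + 2 * R * \<bar>b\<bar>) * norm (p - q)"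
proof -
  have R: "R \<ge> 0" using assms(1) norm_ge_zero order_trans by blast
  have eq: "shear n b p - shear n b q = (p - q) +
      (if even n then (0, of_real b * ((fst p)\<^sup>2 - (fst q)\<^sup>2)) else (of_real b * ((snd p)\<^sup>2 - (snd q)\<^sup>2), 0))"
    by (cases p; cases q) (simp add: shear_def algebra_simps)
  have "norm (if even n then (0, of_real b * ((fst p)\<^sup>2 - (fst q)\<^sup>2)) else (of_real b * ((snd p)\<^sup>2 - (snd q)\<^sup>2), 0))
     \<le> \<bar>b\<bar> * (2 * R * norm (p - q))"
  proof -
    have "cmod ((fst p)\<^sup>2 - (fst q)\<^sup>2) \<le> 2 * R * cmod (fst (p - q))"
      using norm_square_diff[of "fst p" R "fst q"] norm_fst_c2[of p] norm_fst_c2[of q] assms by simp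
    also have "\<dots> \<le> 2 * R * norm (p - q)" using R norm_fst_c2[of "p - q"] by (intro mult_left_mono) auto
    finally have 1: "cmod ((fst p)\<^sup>2 - (fst q)\<^sup>2) \<le> 2 * R * norm (p - q)" .
    have "cmod ((snd p)\<^sup>2 - (snd q)\<^sup>2) \<le> 2 * R * cmod (snd (p - q))"
      using norm_square_diff[of "snd p" R "snd q"] norm_snd_c2[of p] norm_snd_c2[of q] assms by simp
    also have "\<dots> \<le> 2 * R * norm (p - q)" using R norm_snd_c2[of "p - q"] by (intro mult_left_mono) auto
    finally have 2: "cmod ((snd p)\<^sup>2 - (snd q)\<^sup>2) \<le> 2 * R * norm (p - q)" .
    show ?thesis
      using mult_left_mono[OF 1 abs_ge_zero[of b]] mult_left_mono[OF 2 abs_ge_zero[of b]]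
      by (simp add: norm_zero_Pair norm_Pair_zero norm_mult)
  qed
  then show ?thesis
    unfolding eq
    using norm_triangle_ineq[of "p - q" "if even n then (0, of_real b * ((fst p)\<^sup>2 - (fst q)\<^sup>2)) else (of_real b * ((snd p)\<^sup>2 - (snd q)\<^sup>2), 0)"]
    by (simp only: algebra_simps)
qed

lemma holo2_on_shear: "holo2_on (shear n b) U"
  unfolding holo2_on_def
proof
  fix p
  have d: "(shear n b has_derivative (\<lambda>v. if even n then (fst v, snd v + of_real b * (2 * fst p * fst v))
     else (fst v + of_real b * (2 * snd p * snd v), snd v))) (at p)"
    unfolding shear_def
    by (cases "even n") (auto intro!: derivative_eq_intros simp: algebra_simps)
  show "\<exists>L. clinear2 L \<and> (shear n b has_derivative L) (at p)"
    unfolding clinear2_def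
    by (rule exI, intro conjI, rule has_derivative_linear, rule d)
       (use d in \<open>auto simp: cscale2_def algebra_simps\<close>)
qed

primrec shears :: "(nat \<Rightarrow> real) \<Rightarrow> nat \<Rightarrow> c2 \<Rightarrow> c2" where
  "shears b 0 p = p"
| "shears b (Suc n) p = shear n (b n) (shears b n p)"

primrec shears_inv :: "(nat \<Rightarrow> real) \<Rightarrow> nat \<Rightarrow> c2 \<Rightarrow> c2" where
  "shears_inv b 0 p = p"
| "shears_inv b (Suc n) p = shears_inv b n (shear n (- b n) p)"

lemma shears_shears_inv: "shears b n (shears_inv b n p) = p"
  by (induction n arbitrary: p) (simp_all add: shear_inverse)

lemma shears_inv_shears: "shears_inv b n (shears b n p) = p"
  by (induction n arbitrary: p) (simp_all add: shear_inverse)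

lemma holo2_on_shears: "holo2_on (shears b n) U"
proof (induction n)
  case 0
  then show ?case using holo2_on_id by simp
next
  case (Suc n)
  show ?case using holo2_on_compose[OF Suc holo2_on_shear[of n "b n" UNIV]] by simp
qed

lemma holo2_on_shears_inv: "holo2_on (shears_inv b n) U"
proof (induction n arbitrary: U)
  case 0
  then show ?case using holo2_on_id by simp
next
  case (Suc n)
  show ?case using holo2_on_compose[OF holo2_on_shear Suc[of UNIV]] by simp
qed

text \<open>The constant depends on \<open>n\<close>; the bound serves for the finitely many initial
  factors, before the coefficients become small.\<close>

lemma shears_inv_lipschitz_ball:
  "\<exists>C\<ge>0. \<forall>p\<in>cball 0 R. \<forall>q\<in>cball 0 R. norm (shears_inv b n p - shears_inv b n q) \<le> C * norm (p - q)"
proof (induction n arbitrary: R)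
  case 0
  show ?case by (intro exI[of _ 1]) simp
next
  case (Suc n)
  define R' where "R' = R + \<bar>b n\<bar> * R\<^sup>2"
  obtain C where C: "C \<ge> 0"
    "\<And>p q. p \<in> cball 0 R' \<Longrightarrow> q \<in> cball 0 R' \<Longrightarrow> norm (shears_inv b n p - shears_inv b n q) \<le> C * norm (p - q)"
    using Suc[of R'] by blast
  define T where "T = shear n (- b n)"
  have T: "T p \<in> cball 0 R'" if "p \<in> cball 0 R" for p
  proof -
    have "norm (T p) \<le> norm p + \<bar>b n\<bar> * (norm p)\<^sup>2" using norm_shear[of n "- b n" p] by (simp add: T_def)
    also have "\<dots> \<le> R'" unfolding R'_def using that by (intro add_mono mult_left_mono power_mono) simp_all
    finally show ?thesis by simp
  qed
  have "norm (shears_inv b n (T p) - shears_inv b n (T q)) \<le> (C * (1 + 2 * \<bar>R\<bar> * \<bar>b n\<bar>)) * norm (p - q)"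
    if "p \<in> cball 0 R" "q \<in> cball 0 R" for p q
  proof -
    have "norm (shears_inv b n (T p) - shears_inv b n (T q)) \<le> C * norm (T p - T q)"
      by (rule C(2)[OF T[OF that(1)] T[OF that(2)]])
    also have "norm (T p - T q) \<le> (1 + 2 * \<bar>R\<bar> * \<bar>- b n\<bar>) * norm (p - q)"
      unfolding T_def by (rule shear_lipschitz) (use that in simp_all)
    finally show ?thesis using C(1) by (simp add: mult_left_mono mult.assoc)
  qed
  then show ?case
    using C(1) by (intro exI[of _ "C * (1 + 2 * \<bar>R\<bar> * \<bar>b n\<bar>)"]) (simp add: T_def)
qed

section \<open>Convergence of the inverse compositions on the whole space\<close>

context
  fixes b :: "nat \<Rightarrow> real"
  assumes b_pos: "\<And>n. b n > 0" and b_Suc: "\<And>n. b (Suc n) \<le> b n / 8"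
begin

lemma b_add: "b (N + j) \<le> b N * (1/8) ^ j"
proof (induction j)
  case (Suc j)
  then show ?case using b_Suc[of "N + j"] by simp
qed simp

lemma b_summable: "summable b"
  by (rule summable_ratio_test[of "1/8" 0]) (use b_pos b_Suc in \<open>simp_all add: less_imp_le\<close>)

lemma b_tendsto_zero: "b \<longlonglongrightarrow> 0"
  using b_summable by (rule summable_LIMSEQ_zero)

text \<open>Past the index \<open>N\<close> the radii \<open>R (1 + 8^-j)\<close> absorb the growth under the inverse shears.\<close>

lemma b_small:
  assumes "R > 0"
  obtains N where "\<And>j. 4 * R * b (N + j) \<le> 7/8 * (1/8) ^ j"
proof -
  have "(\<lambda>n. 4 * R * b n) \<longlonglongrightarrow> 4 * R * 0" by (intro tendsto_intros b_tendsto_zero)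
  then have "\<forall>\<^sub>F n in sequentially. 4 * R * b n < 7/8" by (rule order_tendstoD) simp
  then obtain N where N: "4 * R * b N < 7/8" by (auto simp: eventually_sequentially)
  have "4 * R * b (N + j) \<le> 7/8 * (1/8) ^ j" for j
  proof -
    have "4 * R * b (N + j) \<le> 4 * R * (b N * (1/8) ^ j)" using assms b_add by (intro mult_left_mono) auto
    also have "\<dots> = 4 * R * b N * (1/8) ^ j" by simp
    also have "\<dots> \<le> 7/8 * (1/8) ^ j" using N by (intro mult_right_mono) auto
    finally show ?thesis .
  qed
  then show thesis using that by blast
qed

text \<open>Points of norm at most \<open>2 * R\<close> move by at most
  \<open>R * (4 * R * b (N + j))\<close>, and \<open>7/8 * (1/8) ^ j\<close> is exactly the gap
  between \<open>(1/8) ^ j\<close> and \<open>(1/8) ^ Suc j\<close>.\<close>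

lemma shear_inv_radius:
  assumes R: "R > 0" and N: "\<And>j. 4 * R * b (N + j) \<le> 7/8 * (1/8) ^ j"
    and p: "norm p \<le> R * (1 + (1/8) ^ Suc j)"
  shows "norm (shear (N + j) (- b (N + j)) p) \<le> R * (1 + (1/8) ^ j)"
proof -
  have pow: "(1/8) ^ Suc j \<le> (1::real)" by (rule power_le_one) auto
  have "norm p \<le> R * 2" by (rule order_trans[OF p]) (use R pow in \<open>intro mult_left_mono; simp\<close>)
  then have p2: "(norm p)\<^sup>2 \<le> (R * 2)\<^sup>2" by (intro power_mono) auto
  have "norm (shear (N + j) (- b (N + j)) p) \<le> norm p + b (N + j) * (norm p)\<^sup>2"
    using norm_shear[of "N + j" "- b (N + j)" p] b_pos[of "N + j"] by simp
  also have "\<dots> \<le> R * (1 + (1/8) ^ Suc j) + b (N + j) * (R * 2)\<^sup>2"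
    using p p2 b_pos[of "N + j"] by (intro add_mono mult_left_mono) auto
  also have "b (N + j) * (R * 2)\<^sup>2 = R * (4 * R * b (N + j))" by (simp add: power2_eq_square)
  also have "R * (1 + (1/8) ^ Suc j) + \<dots> \<le> R * (1 + (1/8) ^ Suc j) + R * (7/8 * (1/8) ^ j)"
    using R N[of j] by (intro add_mono mult_left_mono) auto
  also have "\<dots> = R * (1 + (1/8) ^ j)" by (simp add: algebra_simps)
  finally show ?thesis .
qed

text \<open>On the ball of radius \<open>2 * R\<close> the shear with index \<open>N + j\<close> has
  Lipschitz constant at most \<open>exp (7/4 * (1/8) ^ j)\<close>. The exponents form a geometric
  series with partial sums \<open>2 - 2 * (1/8) ^ j\<close>, so the product stays below
  \<open>exp 2\<close>.\<close>

lemma shears_inv_lipschitz_uniform: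
  assumes R: "R > 0" and N: "\<And>j. 4 * R * b (N + j) \<le> 7/8 * (1/8) ^ j"
  obtains C where "C \<ge> 0"
    "\<And>j p q. norm p \<le> R * (1 + (1/8) ^ j) \<Longrightarrow> norm q \<le> R * (1 + (1/8) ^ j) \<Longrightarrow>
       norm (shears_inv b (N + j) p - shears_inv b (N + j) q) \<le> C * norm (p - q)"
proof -
  obtain C where C: "C \<ge> 0" "\<And>p q. p \<in> cball 0 (R * 2) \<Longrightarrow> q \<in> cball 0 (R * 2) \<Longrightarrow>
      norm (shears_inv b N p - shears_inv b N q) \<le> C * norm (p - q)"
    using shears_inv_lipschitz_ball[of "R * 2" b N] by blast
  have *: "norm (shears_inv b (N + j) p - shears_inv b (N + j) q)
      \<le> C * exp (2 - 2 * (1/8) ^ j) * norm (p - q)"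
    if "norm p \<le> R * (1 + (1/8) ^ j)" "norm q \<le> R * (1 + (1/8) ^ j)" for j p q
    using that
  proof (induction j arbitrary: p q)
    case 0
    then show ?case using C(2)[of p q] by simp
  next
    case (Suc j)
    define T where "T = shear (N + j) (- b (N + j))"
    have pow: "(1/8) ^ Suc j \<le> (1::real)" by (rule power_le_one) auto
    have le2: "R * (1 + (1/8) ^ Suc j) \<le> R * 2" using R pow by (intro mult_left_mono) auto
    have "norm (T p - T q) \<le> (1 + 2 * (R * 2) * \<bar>- b (N + j)\<bar>) * norm (p - q)"
      unfolding T_def by (rule shear_lipschitz) (use Suc.prems le2 in linarith)+
    also have "1 + 2 * (R * 2) * \<bar>- b (N + j)\<bar> \<le> exp ((7/4) * (1/8) ^ j)"
    proof -
      have "1 + 2 * (R * 2) * \<bar>- b (N + j)\<bar> \<le> 1 + (7/4) * (1/8) ^ j"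
      proof -
        have "2 * (R * 2) * \<bar>- b (N + j)\<bar> = 4 * R * b (N + j)" using b_pos[of "N + j"] by simp
        then show ?thesis using N[of j] zero_le_power[of "1/8::real" j] by linarith
      qed
      also have "\<dots> \<le> exp ((7/4) * (1/8) ^ j)" by (rule exp_ge_add_one_self)
      finally show ?thesis .
    qed
    finally have T: "norm (T p - T q) \<le> exp ((7/4) * (1/8) ^ j) * norm (p - q)"
      by (simp add: mult_right_mono)
    have "norm (shears_inv b (N + j) (T p) - shears_inv b (N + j) (T q))
        \<le> C * exp (2 - 2 * (1/8) ^ j) * norm (T p - T q)"
      unfolding T_def by (intro Suc.IH shear_inv_radius[OF R N] Suc.prems)
    also have "\<dots> \<le> C * exp (2 - 2 * (1/8) ^ j) * (exp ((7/4) * (1/8) ^ j) * norm (p - q))"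
      using C(1) T by (intro mult_left_mono) auto
    also have "\<dots> = C * (exp (2 - 2 * (1/8) ^ j) * exp ((7/4) * (1/8) ^ j)) * norm (p - q)" by simp
    also have "exp (2 - 2 * (1/8) ^ j) * exp ((7/4) * (1/8) ^ j) = exp (2 - 2 * (1/8 :: real) ^ Suc j)"
      by (simp add: exp_add[symmetric])
    finally show ?case by (simp add: T_def)
  qed
  show thesis
  proof (rule that[of "C * exp 2"])
    show "C * exp 2 \<ge> 0" using C(1) by simp
    fix j and p q :: c2 assume pq: "norm p \<le> R * (1 + (1/8) ^ j)" "norm q \<le> R * (1 + (1/8) ^ j)"
    have "C * exp (2 - 2 * (1/8) ^ j) * norm (p - q) \<le> C * exp 2 * norm (p - q)"
      using C(1) by (intro mult_right_mono mult_left_mono) auto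
    with *[OF pq] show "norm (shears_inv b (N + j) p - shears_inv b (N + j) q) \<le> C * exp 2 * norm (p - q)"
      by linarith
  qed
qed

definition shears_inv_lim :: "c2 \<Rightarrow> c2" where
  "shears_inv_lim q = lim (\<lambda>n. shears_inv b n q)"

definition shears_lim :: "c2 \<Rightarrow> c2" where
  "shears_lim p = lim (\<lambda>n. shears b n p)"

text \<open>Consecutive inverse compositions differ by one innermost shear, so the uniform Lipschitz
  bound makes the increments at most a constant times the summable \<open>b n\<close>.\<close>

lemma uniform_limit_shears_inv:
  assumes R: "R > 0"
  shows "uniform_limit (cball 0 R) (shears_inv b) shears_inv_lim sequentially"
proof -
  obtain N where N: "\<And>j. 4 * R * b (N + j) \<le> 7/8 * (1/8) ^ j"
    using b_small[OF R] by blast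
  obtain C where C: "C \<ge> 0"
    "\<And>j p q. norm p \<le> R * (1 + (1/8) ^ j) \<Longrightarrow> norm q \<le> R * (1 + (1/8) ^ j) \<Longrightarrow>
       norm (shears_inv b (N + j) p - shears_inv b (N + j) q) \<le> C * norm (p - q)"
    by (rule shears_inv_lipschitz_uniform[OF R N]) blast
  have "norm (shears_inv b (Suc n) q - shears_inv b n q) \<le> b n * (C * R\<^sup>2)"
    if n: "n \<ge> N" and q: "q \<in> cball 0 R" for n q
  proof -
    obtain j where j: "n = N + j" using le_Suc_ex[OF n] by blast
    have "R \<le> R * (1 + (1/8) ^ i)" for i using R by simp
    then have q': "norm q \<le> R * (1 + (1/8) ^ i)" for i using q by (simp add: order_trans)
    have "norm (shears_inv b (Suc n) q - shears_inv b n q) \<le> C * norm (shear n (- b n) q - q)"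
      using C(2)[OF shear_inv_radius[OF R N q'] q'] by (simp add: j)
    also have "\<dots> \<le> C * (b n * R\<^sup>2)"
    proof (rule mult_left_mono[OF _ C(1)])
      have "norm (shear n (- b n) q - q) \<le> b n * (norm q)\<^sup>2"
        using norm_shear_diff[of n "- b n" q] b_pos[of n] by simp
      also have "\<dots> \<le> b n * R\<^sup>2"
        using q b_pos[of n] by (intro mult_left_mono power_mono) (simp_all add: less_imp_le)
      finally show "norm (shear n (- b n) q - q) \<le> b n * R\<^sup>2" .
    qed
    finally show ?thesis by (simp add: mult_ac)
  qed
  then show ?thesis
    unfolding shears_inv_lim_def
    by (rule uniform_limit_increments) (use b_summable in \<open>auto intro: summable_mult2\<close>)
qed

lemma shears_inv_tendsto: "(\<lambda>n. shears_inv b n q) \<longlonglongrightarrow> shears_inv_lim q"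
  by (rule tendsto_uniform_limitI[OF uniform_limit_shears_inv[of "norm q + 1"]])
    (simp_all add: add_nonneg_pos)

lemma holo2_on_shears_inv_lim: "holo2_on shears_inv_lim UNIV"
  unfolding holo2_on_def
proof
  fix x :: c2
  have R: "norm x + 1 > 0" by (simp add: add_nonneg_pos)
  have "ball x 1 \<subseteq> cball 0 (norm x + 1)"
  proof
    fix y assume "y \<in> ball x 1"
    then show "y \<in> cball 0 (norm x + 1)"
      using norm_triangle_ineq2[of y x] by (simp add: dist_norm norm_minus_commute)
  qed
  then have "uniform_limit (ball x 1) (shears_inv b) shears_inv_lim sequentially"
    using uniform_limit_on_subset uniform_limit_shears_inv[OF R] by blast
  then show "\<exists>L. clinear2 L \<and> (shears_inv_lim has_derivative L) (at x)"
    by (rule holo2_uniform_limit_at[OF zero_less_one holo2_on_shears_inv])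
qed

text \<open>Applying \<open>shears b m\<close> to \<open>shears_inv b n q\<close> cancels the first
  \<open>m\<close> factors; the remaining inverse shears keep \<open>q\<close> within radius
  \<open>2 * R\<close>. Letting \<open>n\<close> grow gives the bound for the limit point, which
  will place it in the basin.\<close>

lemma shears_of_inv_lim_bounded:
  obtains N K where "\<And>m. m \<ge> N \<Longrightarrow> norm (shears b m (shears_inv_lim q)) \<le> K"
proof -
  define R where "R = norm q + 1"
  have R: "R > 0" by (simp add: R_def add_nonneg_pos)
  obtain N where N: "\<And>j. 4 * R * b (N + j) \<le> 7/8 * (1/8) ^ j"
    using b_small[OF R] by blast
  have rad: "norm (shears b (N + i) (shears_inv b (N + i + k) q')) \<le> R * (1 + (1/8) ^ i)"
    if "norm q' \<le> R * (1 + (1/8) ^ (i + k))" for i k q'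
    using that
  proof (induction k arbitrary: q')
    case 0
    then show ?case by (simp add: shears_shears_inv)
  next
    case (Suc k)
    have "norm (shear (N + (i + k)) (- b (N + (i + k))) q') \<le> R * (1 + (1/8) ^ (i + k))"
      using Suc.prems by (intro shear_inv_radius[OF R N]) simp
    from Suc.IH[OF this] show ?case by (simp add: add.assoc)
  qed
  have "norm (shears b m (shears_inv_lim q)) \<le> R * 2" if m: "m \<ge> N" for m
  proof (rule tendsto_upperbound[where F = sequentially])
    obtain i where i: "m = N + i" using le_Suc_ex[OF m] by blast
    have "isCont (shears b m) (shears_inv_lim q)"
      using holo2_on_continuous[OF holo2_on_shears] continuous_on_eq_continuous_at[OF open_UNIV] by blast
    then show "(\<lambda>n. norm (shears b m (shears_inv b n q))) \<longlonglongrightarrow> norm (shears b m (shears_inv_lim q))"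
      by (intro tendsto_norm isCont_tendsto_compose[OF _ shears_inv_tendsto])
    have "norm (shears b m (shears_inv b n q)) \<le> R * 2" if nm: "n \<ge> m" for n
    proof -
      obtain k where k: "n = m + k" using le_Suc_ex[OF nm] by blast
      have "R \<le> R * (1 + (1/8) ^ (i + k))" using R by simp
      then have "norm q \<le> R * (1 + (1/8) ^ (i + k))" by (simp add: R_def)
      from rad[OF this] have "norm (shears b m (shears_inv b n q)) \<le> R * (1 + (1/8) ^ i)"
        by (simp add: i k)
      also have "\<dots> \<le> R * 2"
        using R power_le_one[of "1/8::real" i] by (intro mult_left_mono) auto
      finally show ?thesis .
    qed
    then show "\<forall>\<^sub>F n in sequentially. norm (shears b m (shears_inv b n q)) \<le> R * 2"
      using eventually_sequentially by blast
  qed simp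
  then show thesis using that by blast
qed

end

section \<open>Comparison of the iterates with compositions of shears\<close>

context
  fixes a :: "nat \<Rightarrow> real"
  assumes a_pos: "\<And>n. a n > 0" and a_le: "\<And>n. a n \<le> 1"
    and a_Suc: "\<And>n. 8 * (a n)\<^sup>2 \<le> a (Suc n)"
    and a_slow: "\<And>e. e > 0 \<Longrightarrow> \<exists>N. \<forall>n\<ge>N. exp (- (e * 2 ^ n)) \<le> a n"
begin

definition aprod :: "nat \<Rightarrow> real" where
  "aprod n = (\<Prod>k<n. a k)"

text \<open>The coefficient of the \<open>n\<close>-th rescaled shear: squaring produces
  \<open>(aprod n)^2\<close>, and the new scale \<open>aprod n * a n\<close> is divided out.\<close>

definition bcoeff :: "nat \<Rightarrow> real" where
  "bcoeff n = aprod n / a n"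

lemma aprod_pos: "aprod n > 0"
  using a_pos by (simp add: aprod_def prod_pos)

lemma bcoeff_pos: "bcoeff n > 0"
  using a_pos aprod_pos by (simp add: bcoeff_def)

text \<open>The quotient of consecutive coefficients is \<open>(a n)^2 / a (Suc n)\<close>, which is
  what \<open>a_Suc\<close> controls.\<close>

lemma bcoeff_Suc: "bcoeff (Suc n) \<le> bcoeff n / 8"
proof -
  have "bcoeff (Suc n) = bcoeff n * ((a n)\<^sup>2 / a (Suc n))"
    using a_pos[of n] by (simp add: bcoeff_def aprod_def power2_eq_square)
  also have "\<dots> \<le> bcoeff n * (1/8)"
    using a_Suc[of n] a_pos[of "Suc n"] bcoeff_pos[of n]
    by (intro mult_left_mono) (simp_all add: field_simps)
  finally show ?thesis by simp
qed

lemmas bfacts = bcoeff_pos bcoeff_Suc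

lemma aprod_tendsto_zero: "aprod \<longlonglongrightarrow> 0"
proof (rule tendsto_sandwich[OF _ _ tendsto_const b_tendsto_zero[of bcoeff, OF bfacts]])
  have "aprod n \<le> bcoeff n" for n
    using a_pos[of n] a_le[of n] aprod_pos[of n] by (simp add: bcoeff_def field_simps)
  then show "\<forall>\<^sub>F n in sequentially. aprod n \<le> bcoeff n" by simp
qed (use aprod_pos in \<open>simp add: less_imp_le\<close>)

text \<open>Conjugating the shears \<open>(z, w + z^2 / a)\<close> by the linear parts \<open>(z, w) \<mapsto> (a w, a z)\<close>
  alternates the two coordinates.\<close>

lemma hcomp_eq_shears:
  "hcomp a n p = (if even n then cscale2 (of_real (aprod n)) (shears bcoeff n p)
     else cscale2 (of_real (aprod n)) (snd (shears bcoeff n p), fst (shears bcoeff n p)))"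
proof (induction n)
  case 0
  show ?case by (simp add: aprod_def cscale2_def)
next
  case (Suc n)
  have "aprod (Suc n) = aprod n * a n" "aprod n = bcoeff n * a n"
    using a_pos[of n] by (simp_all add: aprod_def bcoeff_def)
  then show ?case
    using Suc by (simp add: hmap_def cscale2_def shear_def power2_eq_square algebra_simps)
qed

lemma norm_hcomp: "norm (hcomp a n p) = aprod n * norm (shears bcoeff n p)"
  using aprod_pos[of n] by (simp add: hcomp_eq_shears norm_cscale2 norm_swap)

section \<open>Traps, where the linear part dominates\<close>

text \<open>Below \<open>a N\<close> the bound for the quadratic term in \<open>norm_hmap\<close> is
  at most the bound for the linear term.\<close>

definition trap :: "nat \<Rightarrow> c2 set" where
  "trap N = {p. norm (hcomp a N p) < a N}"

lemma open_trap: "open (trap N)"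
  unfolding trap_def by (intro open_Collect_less continuous_intros continuous_on_hcomp)

text \<open>With norm \<open>m\<close> at most the coefficient \<open>A\<close> the next norm is at
  most \<open>2 * A * m\<close>. As the next coefficient is at least \<open>8 * A^2\<close>, the
  ratio of norm to coefficient drops by the factor 1/4.\<close>

lemma trap_decay:
  assumes "p \<in> trap N"
  shows "norm (hcomp a (N + j) p) \<le> (1/4) ^ j * a (N + j)"
proof (induction j)
  case 0
  show ?case using assms by (simp add: trap_def)
next
  case (Suc j)
  define m A where "m = norm (hcomp a (N + j) p)" and "A = a (N + j)"
  have m: "0 \<le> m" "m \<le> (1/4) ^ j * A" using Suc by (simp_all add: m_def A_def)
  have A: "A > 0" by (simp add: A_def a_pos)
  have "(1/4) ^ j * A \<le> 1 * A" using A by (intro mult_right_mono power_le_one) auto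
  then have mA: "m \<le> A" using m by simp
  have "norm (hcomp a (Suc (N + j)) p) \<le> m\<^sup>2 + A * m"
    using norm_hmap[of A "hcomp a (N + j) p"] A by (simp add: m_def A_def)
  also have "\<dots> \<le> A * m + A * m"
    using mA m by (simp add: power2_eq_square mult_right_mono)
  also have "\<dots> = 2 * A * m" by simp
  also have "\<dots> \<le> 2 * A * ((1/4) ^ j * A)" using m A by (intro mult_left_mono) auto
  also have "\<dots> = (1/4) ^ Suc j * (8 * A\<^sup>2)" by (simp add: power2_eq_square)
  also have "\<dots> \<le> (1/4) ^ Suc j * a (Suc (N + j))"
    using a_Suc[of "N + j"] by (intro mult_left_mono) (simp_all add: A_def)
  finally show ?case by simp
qed

text \<open>The shear with index \<open>N + j\<close> enlarges the norm by a factor of at most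
  \<open>1 + (1/4) ^ j\<close>. The product of these factors converges; the exponents
  \<open>3/2 * (1/4) ^ j\<close> add up to \<open>2 - 2 * (1/4) ^ j\<close>.\<close>

lemma trap_bound:
  assumes "p \<in> trap N" "n \<ge> N"
  shows "norm (shears bcoeff n p) \<le> exp 2 * (a N / aprod N)"
proof -
  have *: "norm (shears bcoeff (N + j) p) \<le> (a N / aprod N) * exp (2 - 2 * (1/4) ^ j)" for j
  proof (induction j)
    case 0
    show ?case using assms(1) aprod_pos[of N] by (simp add: trap_def norm_hcomp field_simps)
  next
    case (Suc j)
    define M where "M = norm (shears bcoeff (N + j) p)"
    have "aprod (N + j) * M \<le> (1/4) ^ j * a (N + j)"
      using trap_decay[OF assms(1), of j] by (simp add: norm_hcomp M_def)
    then have bM: "bcoeff (N + j) * M \<le> (1/4) ^ j"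
      using a_pos[of "N + j"] by (simp add: bcoeff_def pos_divide_le_eq)
    have M: "0 \<le> M" "M \<le> (a N / aprod N) * exp (2 - 2 * (1/4) ^ j)" using Suc by (simp_all add: M_def)
    have "norm (shears bcoeff (N + Suc j) p) \<le> M + bcoeff (N + j) * M\<^sup>2"
      using norm_shear[of "N + j" "bcoeff (N + j)" "shears bcoeff (N + j) p"] bcoeff_pos[of "N + j"]
      by (simp add: M_def)
    also have "\<dots> = M * (1 + bcoeff (N + j) * M)" by (simp add: power2_eq_square algebra_simps)
    also have "\<dots> \<le> M * exp (3/2 * (1/4) ^ j)"
    proof (intro mult_left_mono M(1))
      have "1 + bcoeff (N + j) * M \<le> 1 + 3/2 * (1/4) ^ j"
        using bM zero_le_power[of "1/4::real" j] by linarith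
      also have "\<dots> \<le> exp (3/2 * (1/4) ^ j)" by (rule exp_ge_add_one_self)
      finally show "1 + bcoeff (N + j) * M \<le> exp (3/2 * (1/4) ^ j)" .
    qed
    also have "\<dots> \<le> (a N / aprod N) * exp (2 - 2 * (1/4) ^ j) * exp (3/2 * (1/4) ^ j)"
      using M by (intro mult_right_mono) auto
    also have "\<dots> = (a N / aprod N) * (exp (2 - 2 * (1/4) ^ j) * exp (3/2 * (1/4) ^ j))" by simp
    also have "exp (2 - 2 * (1/4) ^ j) * exp (3/2 * (1/4) ^ j) = exp (2 - 2 * (1/4 :: real) ^ Suc j)"
      by (simp add: exp_add[symmetric])
    finally show ?case .
  qed
  obtain j where j: "n = N + j" using le_Suc_ex[OF assms(2)] by blast
  have "(a N / aprod N) * exp (2 - 2 * (1/4) ^ j) \<le> (a N / aprod N) * exp 2"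
    using a_pos[of N] aprod_pos[of N] by (intro mult_left_mono) (auto simp: less_imp_le)
  with *[of j] show ?thesis by (simp add: j mult.commute)
qed

lemma hbasin_if_shears_bounded:
  assumes "\<And>m. m \<ge> N \<Longrightarrow> norm (shears bcoeff m p) \<le> K"
  shows "p \<in> hbasin a"
proof -
  have "(\<lambda>n. norm (hcomp a n p)) \<longlonglongrightarrow> 0"
  proof (rule tendsto_sandwich[OF _ _ tendsto_const])
    have "norm (hcomp a n p) \<le> aprod n * K" if "n \<ge> N" for n
      unfolding norm_hcomp using assms[OF that] aprod_pos[of n] by (intro mult_left_mono) auto
    then show "\<forall>\<^sub>F n in sequentially. norm (hcomp a n p) \<le> aprod n * K"
      using eventually_sequentially by blast
    show "(\<lambda>n. aprod n * K) \<longlonglongrightarrow> 0"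
      using tendsto_mult_left_zero[OF aprod_tendsto_zero] by simp
  qed simp
  then show ?thesis unfolding hbasin_def using tendsto_norm_zero_iff by blast
qed

text \<open>An orbit tending to zero without ever entering a trap would satisfy
  \<open>norm (hcomp a (Suc n) p) \<le> 2 * (norm (hcomp a n p))\<^sup>2\<close> for all \<open>n\<close> and so decay doubly exponentially,
  faster than \<open>a\<close>.\<close>

lemma hbasin_eq_trap: "hbasin a = (\<Union>N. trap N)"
proof (intro equalityI subsetI)
  fix p assume "p \<in> (\<Union>N. trap N)"
  then obtain N where N: "p \<in> trap N" by blast
  show "p \<in> hbasin a" by (rule hbasin_if_shears_bounded[OF trap_bound[OF N]])
next
  fix p assume p: "p \<in> hbasin a"
  show "p \<in> (\<Union>N. trap N)"
  proof (rule ccontr)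
    assume "p \<notin> (\<Union>N. trap N)"
    then have ge: "a n \<le> norm (hcomp a n p)" for n by (auto simp: trap_def not_less)
    define m where "m n = norm (hcomp a n p)" for n
    have m_Suc: "m (Suc n) \<le> 2 * (m n)\<^sup>2" for n
    proof -
      have "m (Suc n) \<le> (m n)\<^sup>2 + a n * m n"
        using norm_hmap[of "a n" "hcomp a n p"] a_pos[of n] by (simp add: m_def)
      also have "a n * m n \<le> m n * m n" using ge[of n] by (intro mult_right_mono) (simp_all add: m_def)
      finally show ?thesis by (simp add: power2_eq_square)
    qed
    have "m \<longlonglongrightarrow> 0" unfolding m_def using p tendsto_norm_zero by (auto simp: hbasin_def)
    then have "\<forall>\<^sub>F n in sequentially. m n < exp (-1) / 2" by (rule order_tendstoD) simp
    \<comment> \<open>Then \<open>2 * m N < exp (-1)\<close>, which starts the repeated squaring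
      \<open>2 * m (Suc n) <= (2 * m n)^2\<close>.\<close>
    then obtain N where N: "m N < exp (-1) / 2" by (auto simp: eventually_sequentially)
    have decay: "2 * m (N + k) \<le> exp (- (2 ^ k))" for k
    proof (induction k)
      case 0
      show ?case using N by simp
    next
      case (Suc k)
      have "2 * m (N + Suc k) \<le> (2 * m (N + k))\<^sup>2"
        using m_Suc[of "N + k"] by (simp add: power2_eq_square)
      also have "\<dots> \<le> (exp (- (2 ^ k)))\<^sup>2" using Suc by (intro power_mono) (simp_all add: m_def)
      also have "\<dots> = exp (- (2 ^ Suc k))" by (simp add: exp_double[symmetric])
      finally show ?case .
    qed
    \<comment> \<open>The rate \<open>1 / 2 ^ N\<close> is that of the orbit counted from
      \<open>N\<close>: at index \<open>N + N'\<close> both bounds are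
      \<open>exp (- (2 ^ N'))\<close>, and the factor 2 in \<open>decay\<close> gives the
      contradiction.\<close>
    obtain N' where N': "\<And>n. n \<ge> N' \<Longrightarrow> exp (- ((1 / 2 ^ N) * 2 ^ n)) \<le> a n"
      using a_slow[of "1 / 2 ^ N"] by auto
    have "exp (- (2 ^ N')) \<le> a (N + N')"
      using N'[of "N + N'"] by (simp add: power_add)
    also have "\<dots> \<le> m (N + N')" using ge by (simp add: m_def)
    finally have "2 * exp (- (2 ^ N')) \<le> exp (- (2 ^ N') :: real)" using decay[of N'] by linarith
    then show False by simp
  qed
qed

section \<open>The limit maps as mutually inverse biholomorphisms\<close>

lemma uniform_limit_shears:
  "uniform_limit (trap N) (shears bcoeff) (shears_lim bcoeff) sequentially"
  unfolding shears_lim_def[of bcoeff, OF bfacts]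
proof (rule uniform_limit_increments)
  define K where "K = exp 2 * (a N / aprod N)"
  fix n p assume n: "n \<ge> N" and p: "p \<in> trap N"
  have "norm (shears bcoeff (Suc n) p - shears bcoeff n p) \<le> bcoeff n * (norm (shears bcoeff n p))\<^sup>2"
    using norm_shear_diff[of n "bcoeff n" "shears bcoeff n p"] bcoeff_pos[of n] by simp
  also have "\<dots> \<le> bcoeff n * K\<^sup>2"
    using trap_bound[OF p n] bcoeff_pos[of n] by (intro mult_left_mono power_mono) (simp_all add: K_def less_imp_le)
  finally show "norm (shears bcoeff (Suc n) p - shears bcoeff n p)
      \<le> bcoeff n * (exp 2 * (a N / aprod N))\<^sup>2" by (simp add: K_def)
qed (use b_summable[of bcoeff, OF bfacts] in \<open>auto intro: summable_mult2\<close>)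

lemma shears_inv_lim_in_hbasin: "shears_inv_lim bcoeff q \<in> hbasin a"
  by (rule shears_of_inv_lim_bounded[of bcoeff q, OF bfacts]) (rule hbasin_if_shears_bounded)

lemma shears_lim_inverse: "shears_lim bcoeff (shears_inv_lim bcoeff q) = q"
proof -
  obtain N where N: "shears_inv_lim bcoeff q \<in> trap N"
    using shears_inv_lim_in_hbasin hbasin_eq_trap by blast
  have "(\<lambda>n. shears bcoeff n (shears_inv bcoeff n q)) \<longlonglongrightarrow> shears_lim bcoeff (shears_inv_lim bcoeff q)"
    by (rule uniform_limit_diagonal[OF uniform_limit_shears open_trap N
          holo2_on_continuous[OF holo2_on_shears] shears_inv_tendsto[of bcoeff, OF bfacts]])
  then have "(\<lambda>n::nat. q) \<longlonglongrightarrow> shears_lim bcoeff (shears_inv_lim bcoeff q)"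
    by (simp add: shears_shears_inv)
  then show ?thesis using LIMSEQ_unique tendsto_const by blast
qed

lemma shears_inv_lim_inverse:
  assumes "p \<in> hbasin a"
  shows "shears_inv_lim bcoeff (shears_lim bcoeff p) = p"
proof -
  obtain N where N: "p \<in> trap N" using assms hbasin_eq_trap by blast
  define R where "R = norm (shears_lim bcoeff p) + 1"
  have R: "R > 0" by (simp add: R_def add_nonneg_pos)
  have lim: "uniform_limit (ball 0 R) (shears_inv bcoeff) (shears_inv_lim bcoeff) sequentially"
    using uniform_limit_on_subset[OF uniform_limit_shears_inv[of bcoeff, OF bfacts R] ball_subset_cball] .
  have "(\<lambda>n. shears_inv bcoeff n (shears bcoeff n p)) \<longlonglongrightarrow> shears_inv_lim bcoeff (shears_lim bcoeff p)"
    by (rule uniform_limit_diagonal[OF lim open_ball _ holo2_on_continuous[OF holo2_on_shears_inv]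
          tendsto_uniform_limitI[OF uniform_limit_shears N]]) (simp add: R_def)
  then have "(\<lambda>n::nat. p) \<longlonglongrightarrow> shears_inv_lim bcoeff (shears_lim bcoeff p)"
    by (simp add: shears_inv_shears)
  then show ?thesis using LIMSEQ_unique tendsto_const by blast
qed

lemma fatou_bieberbach_hbasin: "fatou_bieberbach (hbasin a)"
proof -
  have op: "open (hbasin a)" unfolding hbasin_eq_trap using open_trap by blast
  have holo_inv: "holo2_on (shears_inv_lim bcoeff) UNIV"
    by (rule holo2_on_shears_inv_lim[of bcoeff, OF bfacts])
  have "holo2_on (shears_lim bcoeff) (hbasin a)"
    unfolding holo2_on_def
  proof
    fix x assume "x \<in> hbasin a"
    then obtain N where "x \<in> trap N" using hbasin_eq_trap by blast
    then obtain d where d: "d > 0" "ball x d \<subseteq> trap N" using open_trap open_contains_ball by blast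
    show "\<exists>L. clinear2 L \<and> (shears_lim bcoeff has_derivative L) (at x)"
      by (rule holo2_uniform_limit_at[OF d(1) holo2_on_shears
            uniform_limit_on_subset[OF uniform_limit_shears d(2)]])
  qed
  then have "biholomorphic2 (hbasin a) UNIV"
    by (rule biholomorphic2I[OF op open_UNIV _ holo_inv])
      (simp_all add: shears_inv_lim_in_hbasin shears_lim_inverse shears_inv_lim_inverse del: split_paired_All)
  \<comment> \<open>Connectedness is inherited from the whole space through the continuous inverse
    limit.\<close>
  moreover have "hbasin a = range (shears_inv_lim bcoeff)"
    using shears_inv_lim_in_hbasin shears_inv_lim_inverse by (metis image_subset_iff rangeI subsetI subset_antisym)
  then have "connected (hbasin a)"
    using connected_continuous_image[OF holo2_on_continuous[OF holo_inv] connected_UNIV] by simp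
  moreover have "hbasin a \<noteq> {}" using shears_inv_lim_in_hbasin by blast
  ultimately show ?thesis
    using op hbasin_neq_UNIV[of a, OF a_pos] by (simp add: fatou_bieberbach_def domain2_def)
qed

end

subsection \<open>The choice of exponents\<close>

theorem theorem1p7:
  fixes c :: real
  assumes "0 < c" and "c < 1"
  shows "(\<exists>t :: nat \<Rightarrow> real. (\<forall>n\<ge>1. t n > 0) \<and> t \<longlonglongrightarrow> 2 \<and> short_C2 (basin c t))
       \<and> (\<exists>t :: nat \<Rightarrow> real. (\<forall>n\<ge>1. t n > 0) \<and> t \<longlonglongrightarrow> 2 \<and> fatou_bieberbach (basin c t))"
proof
  define s :: "nat \<Rightarrow> real" where "s n = 2 ^ (n + 2)" for n
  have "(\<lambda>n. s n powr (1 / Suc n)) \<longlonglongrightarrow> 2"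
    unfolding s_def by real_asymp
  then obtain t where "\<forall>n\<ge>1. t n > 0" "t \<longlonglongrightarrow> 2" "basin c t = hbasin (\<lambda>n. exp (- s n))"
    using exponents_for_basin[of c s, OF assms] by (auto simp: s_def)
  moreover have "short_C2 (hbasin (\<lambda>n. exp (- s n)))"
    by (rule short_C2_hbasin) (simp add: s_def)
  ultimately show "\<exists>t :: nat \<Rightarrow> real. (\<forall>n\<ge>1. t n > 0) \<and> t \<longlonglongrightarrow> 2 \<and> short_C2 (basin c t)"
    by metis
next
  \<comment> \<open>Division by \<open>n + 2\<close> makes the growth slower than
    \<open>2 ^ n\<close> without changing the limit 2 of the roots. The factor 12 makes
    \<open>2 * s n - s (Suc n)\<close> at least 4, which suffices for the constant 8 in the
    hypothesis on \<open>a\<close>.\<close>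
  define s :: "nat \<Rightarrow> real" where "s n = 12 * 2 ^ n / (n + 2)" for n
  have pos: "s n > 0" for n by (simp add: s_def)
  have "(\<lambda>n. s n powr (1 / Suc n)) \<longlonglongrightarrow> 2"
    unfolding s_def by real_asymp
  then obtain t where "\<forall>n\<ge>1. t n > 0" "t \<longlonglongrightarrow> 2" "basin c t = hbasin (\<lambda>n. exp (- s n))"
    using exponents_for_basin[of c s, OF assms pos] by blast
  moreover have "fatou_bieberbach (hbasin (\<lambda>n. exp (- s n)))"
  proof (rule fatou_bieberbach_hbasin)
    fix n
    show "exp (- s n) > 0" "exp (- s n) \<le> 1" using pos[of n] by simp_all
    \<comment> \<open>Equivalent to \<open>4 <= 2 * s n - s (Suc n)\<close>, with equality at
      \<open>n = 0\<close>.\<close>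
    have "real (n + 2) * real (n + 3) \<le> 6 * 2 ^ n"
    proof (induction n)
      case (Suc n)
      have "real (Suc n + 2) * real (Suc n + 3) \<le> 2 * (real (n + 2) * real (n + 3))"
        by (simp add: algebra_simps)
      with Suc show ?case by simp
    qed simp
    then have "4 * (real (n + 2) * real (n + 3)) \<le> 24 * 2 ^ n" by linarith
    then have "4 \<le> 24 * 2 ^ n / (real (n + 2) * real (n + 3))"
      by (rule pos_le_divide_eq[THEN iffD2, rotated]) simp
    also have "\<dots> = 2 * s n - s (Suc n)"
      by (simp add: s_def field_simps)
    finally have "s (Suc n) - 2 * s n \<le> - (1 + 1 + 1)" by simp
    then have "exp (s (Suc n) - 2 * s n) \<le> exp (- (1 + 1 + 1))" by simp
    also have "\<dots> = inverse (exp 1 * exp 1 * exp 1)" by (simp only: exp_minus exp_add)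
    also have "\<dots> \<le> inverse (2 * 2 * 2)"
      using exp_ge_add_one_self[of 1] by (intro le_imp_inverse_le mult_mono) auto
    finally have "8 * exp (s (Suc n) - 2 * s n) * exp (- s (Suc n)) \<le> 1 * exp (- s (Suc n))"
      by (intro mult_right_mono) auto
    moreover have "exp (s (Suc n) - 2 * s n) * exp (- s (Suc n)) = (exp (- s n))\<^sup>2"
      by (simp add: exp_add[symmetric] exp_double[symmetric])
    ultimately show "8 * (exp (- s n))\<^sup>2 \<le> exp (- s (Suc n))" by (simp only: mult.assoc mult_1_left)
  next
    fix e :: real assume e: "e > 0"
    obtain N where N: "12 / e < real N" using reals_Archimedean2 by blast
    have "exp (- (e * 2 ^ n)) \<le> exp (- s n)" if "n \<ge> N" for n
    proof -
      have "12 / e \<le> real n + 2" using N that by linarith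
      then have "12 \<le> e * (real n + 2)" using e by (simp add: pos_divide_le_eq mult.commute)
      then have "12 * 2 ^ n \<le> e * (real n + 2) * 2 ^ n" by (intro mult_right_mono) auto
      then show ?thesis by (simp add: s_def pos_divide_le_eq mult_ac)
    qed
    then show "\<exists>N. \<forall>n\<ge>N. exp (- (e * 2 ^ n)) \<le> exp (- s n)" by blast
  qed
  ultimately show "\<exists>t :: nat \<Rightarrow> real. (\<forall>n\<ge>1. t n > 0) \<and> t \<longlonglongrightarrow> 2 \<and> fatou_bieberbach (basin c t)"
    by metis
qed

end
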